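(* Let $g=1+\sum_{|\alpha|\ge1}b_\alpha Z_\alpha$ be an admissible free holomorphic function with universal model ${\bf W}=(W_1,\ldots,W_n)$ such that the following conditions hold. (i) For any $i,p\in\{1,\ldots,n\}$, $$\lim_{\gamma\to\infty}\left(\frac{b_{g_p\gamma}}{b_{g_ig_p\gamma}}-\frac{b_\gamma}{b_{g_p\gamma}}\right)=0.$$ (ii) The series $\sum_{|\alpha|\ge1}a_\alpha W_\alpha W_\alpha^*$ is convergent in the operator norm, where $g^{-1}=1+\sum_{|\alpha|\ge1}a_\alpha Z_\alpha$. Then any pure $n$-tuple in $\mathcal D_{g^{-1}}(\mathcal H)$ has a unique minimal dilation up to an isomorphism.
   Context: Fix an integer $n\ge 1$ and an $n$-dimensional complex Hilbert space $H_n$ with orthonormal basis $e_1,\ldots,e_n$. The full Fock space is $F^2(H_n)=\bigoplus_{k\ge0}H_n^{\otimes k}$, $H_n^{\otimes 0}=\mathbb C1$; left creation operators: $S_i\varphi=e_i\otimes\varphi$. $\mathbb F_n^+$ is the unital free semigroup on generators $g_1,\ldots,g_n$ with identity $g_0$; $|\alpha|$ is the length of $\alpha$. For $\alpha=g_{i_1}\cdots g_{i_k}$ put $e_\alpha=e_{i_1}\otimes\cdots\otimes e_{i_k}$, $e_{g_0}=1$, and for operators or indeterminates $X_\alpha=X_{i_1}\cdots X_{i_k}$, $X_{g_0}=I$. A formal power series $g=1+\sum_{|\alpha|\ge1}b_\alpha Z_\alpha$ in noncommuting indeterminates is an admissible free holomorphic function if: (a) $b_\alpha>0$, $b_{g_0}=1$,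 $\sup_{\alpha}\frac{b_\alpha}{b_{g_i\alpha}}<\infty$ for each $i$; (b) $\limsup_{k}(\sum_{|\alpha|=k}b_\alpha^2)^{1/2k}<\infty$; (c) $\sup_{k}\|\sum_{p=0}^k\sum_{|\alpha|=p}a_\alpha W_\alpha W_\alpha^*\|<\infty$, where $g^{-1}=1+\sum_{|\alpha|\ge1}a_\alpha Z_\alpha$ is the formal power series inverse and ${\bf W}=(W_1,\ldots,W_n)$, the universal model of $g$, is given by $W_i=S_iD_i$, $D_ie_\alpha=\sqrt{b_\alpha/b_{g_i\alpha}}\,e_\alpha$. Series $\sum_{|\alpha|\ge 1}a_\alpha W_\alpha W_\alpha^*$ are summed by homogeneous blocks: $\sum_{k\ge1}\sum_{|\alpha|=k}$. Limits $\gamma\to\infty$ are taken along $\mathbb F_n^+$ ordered first by length and then lexicographically (equivalently, as $|\gamma|\to\infty$). For a Hilbert space $\mathcal H$, $\mathcal D_{g^{-1}}(\mathcal H)$ is the set of $X=(X_1,\ldots,X_n)\in B(\mathcal H)^n$ such that $\Delta_{g^{-1}}(X,X^* ):=\sum_{p=0}^\infty\sum_{|\alpha|=p}a_\alpha X_\alpha X_\alpha^*$ converges in the weak operator topology (WOT) and is $\ge0$, and $\sum_{\alpha}b_\alpha X_\alpha\Delta_{g^{-1}}(X,X^* )X_\alpha^*\le I$ (WOT convergence). $X$ is pure if equality holds in the last relation. A dilation of a pure tuple $T\in\mathcal D_{g^{-1}}(\mathcal H)$ is a tuple $(W_1\otimes I_{\mathcal G},\ldots,W_n\otimes I_{\mathcal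 G})$, $\mathcal G$ a Hilbert space, together with an isometry $V:\mathcal H\to F^2(H_n)\otimes\mathcal G$ such that $VT_i^*=(W_i^*\otimes I_{\mathcal G})V$ for all $i$ (so $\mathcal H\cong V\mathcal H$ is co-invariant). It is minimal if $\overline{\mathrm{span}}\{(W_\alpha\otimes I_{\mathcal G})V\mathcal H:\alpha\in\mathbb F_n^+\}=F^2(H_n)\otimes\mathcal G$. "Unique up to an isomorphism" means that a minimal dilation exists and for any two minimal dilations $(\mathcal G,V)$, $(\mathcal G',V')$ there is a unitary $U:F^2(H_n)\otimes\mathcal G\to F^2(H_n)\otimes\mathcal G'$ with $U(W_i\otimes I_{\mathcal G})=(W_i\otimes I_{\mathcal G'})U$ for all $i$ and $UV=V'$. *)

theory Defs
  imports "HOL-Analysis.Analysis"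
begin

subsection \<open>Complex Hilbert spaces\<close>

text \<open>The inner product is linear in its first argument. The real inner product inherited from
  \<^class>\<open>real_inner\<close> is the real part of the complex one, so norm and topology are the usual ones.\<close>

class complex_inner = real_inner +
  fixes scaleC :: "complex \<Rightarrow> 'a \<Rightarrow> 'a"  (infixr "*\<^sub>C" 75)
    and cinner :: "'a \<Rightarrow> 'a \<Rightarrow> complex"
  assumes scaleC_add_right: "c *\<^sub>C (x + y) = c *\<^sub>C x + c *\<^sub>C y"
    and scaleC_add_left: "(c + d) *\<^sub>C x = c *\<^sub>C x + d *\<^sub>C x"
    and scaleC_scaleC: "c *\<^sub>C (d *\<^sub>C x) = (c * d) *\<^sub>C x"
    and scaleC_of_real: "of_real r *\<^sub>C x = r *\<^sub>R x"
    and cinner_commute: "cinner x y = cnj (cinner y x)"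
    and cinner_add_left: "cinner (x + y) z = cinner x z + cinner y z"
    and cinner_scaleC_left: "cinner (c *\<^sub>C x) y = c * cinner x y"
    and inner_eq_Re_cinner: "inner x y = Re (cinner x y)"

class chilbert_space = complex_inner + complete_space

instantiation complex :: chilbert_space
begin
definition "scaleC_complex = (\<lambda>c x :: complex. c * x)"
definition "cinner_complex = (\<lambda>x y :: complex. x * cnj y)"
instance
  by standard (auto simp: scaleC_complex_def cinner_complex_def inner_complex_def
      algebra_simps scaleR_conv_of_real)
end

interpretation complex_vector: vector_space "scaleC :: complex \<Rightarrow> 'a \<Rightarrow> 'a::complex_inner"
proof
  show "1 *\<^sub>C x = x" for x :: 'a
    using scaleC_of_real[of 1 x] by simp
qed (simp_all add: scaleC_add_right scaleC_add_left scaleC_scaleC)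

lemma cinner_self: "cinner x x = of_real ((norm x)\<^sup>2)" for x :: "'a::complex_inner"
proof -
  have "Im (cinner x x) = 0"
    using arg_cong[OF cinner_commute[of x x], of Im] by simp
  then show ?thesis
    by (simp add: complex_eq_iff power2_norm_eq_inner inner_eq_Re_cinner)
qed

lemma cinner_scaleC_right: "cinner x (c *\<^sub>C y) = cnj c * cinner x y"
  for x y :: "'a::complex_inner"
  by (metis cinner_commute cinner_scaleC_left complex_cnj_mult)

lemma cinner_add_right: "cinner x (y + z) = cinner x y + cinner x z"
  for x y z :: "'a::complex_inner"
  by (metis cinner_commute cinner_add_left complex_cnj_add)

lemma norm_scaleC: "norm (c *\<^sub>C x) = cmod c * norm x" for x :: "'a::complex_inner"
proof -
  have "complex_of_real ((norm (c *\<^sub>C x))\<^sup>2) = c * cnj c * of_real ((norm x)\<^sup>2)"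
    unfolding cinner_self[symmetric]
    by (simp only: cinner_scaleC_left cinner_scaleC_right mult_ac)
  also have "\<dots> = of_real ((cmod c * norm x)\<^sup>2)"
    by (simp add: complex_norm_square[symmetric] power_mult_distrib)
  finally have "complex_of_real ((norm (c *\<^sub>C x))\<^sup>2) = of_real ((cmod c * norm x)\<^sup>2)" .
  then have "(norm (c *\<^sub>C x))\<^sup>2 = (cmod c * norm x)\<^sup>2"
    by (simp only: of_real_eq_iff)
  then show ?thesis
    by (simp add: power2_eq_iff_nonneg)
qed

lemma cmod_cinner_le: "cmod (cinner x y) \<le> norm x * norm y" for x y :: "'a::complex_inner"
proof (cases "cinner x y = 0")
  case False
  define c where "c = cnj (sgn (cinner x y))"
  have c: "cmod c = 1" "c * cinner x y = of_real (cmod (cinner x y))"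
    using False complex_norm_square[of "cinner x y"]
    by (simp add: c_def norm_sgn)
       (use False complex_norm_square[of "cinner x y"] in
         \<open>simp add: c_def sgn_div_norm scaleR_conv_of_real field_simps power2_eq_square\<close>)
  have "cmod (cinner x y) = inner (c *\<^sub>C x) y"
    by (simp add: inner_eq_Re_cinner cinner_scaleC_left c)
  also have "\<dots> \<le> norm (c *\<^sub>C x) * norm y"
    by (rule norm_cauchy_schwarz)
  finally show ?thesis
    by (simp add: norm_scaleC c)
qed auto

subsection \<open>Square-summable families\<close>

typedef (overloaded) ('i, 'a::complex_inner) l2 =
  "{f :: 'i \<Rightarrow> 'a. (\<lambda>i. (norm (f i))\<^sup>2) summable_on UNIV}"
  morphisms l2_coord Abs_l2
  by (rule exI[of _ "\<lambda>_. 0"]) auto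

lemma l2_summable: "(\<lambda>i. (norm (l2_coord f i))\<^sup>2) summable_on UNIV"
  using l2_coord[of f] by simp

lemma l2_eqI: "(\<And>i. l2_coord f i = l2_coord g i) \<Longrightarrow> f = g"
  by (metis ext l2_coord_inject)

lemma l2_add_summable:
  fixes f g :: "'i \<Rightarrow> 'a::complex_inner"
  assumes "(\<lambda>i. (norm (f i))\<^sup>2) summable_on UNIV" "(\<lambda>i. (norm (g i))\<^sup>2) summable_on UNIV"
  shows "(\<lambda>i. (norm (f i + g i))\<^sup>2) summable_on UNIV"
proof (rule summable_on_comparison_test)
  show "(\<lambda>i. 2 * (norm (f i))\<^sup>2 + 2 * (norm (g i))\<^sup>2) summable_on UNIV"
    by (intro summable_on_add summable_on_cmult_right assms)
  show "(norm (f i + g i))\<^sup>2 \<le> 2 * (norm (f i))\<^sup>2 + 2 * (norm (g i))\<^sup>2" for i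
  proof -
    have "(norm (f i + g i))\<^sup>2 \<le> (norm (f i) + norm (g i))\<^sup>2"
      by (simp add: norm_triangle_ineq power_mono)
    also have "\<dots> \<le> 2 * (norm (f i))\<^sup>2 + 2 * (norm (g i))\<^sup>2"
      using sum_squares_ge_zero[of "norm (f i) - norm (g i)" 0]
      by (simp add: power2_eq_square algebra_simps)
    finally show ?thesis .
  qed
qed auto

lemma l2_scaleC_summable:
  fixes f :: "'i \<Rightarrow> 'a::complex_inner"
  assumes "(\<lambda>i. (norm (f i))\<^sup>2) summable_on UNIV"
  shows "(\<lambda>i. (norm (c *\<^sub>C f i))\<^sup>2) summable_on UNIV"
  by (simp add: norm_scaleC power_mult_distrib summable_on_cmult_right assms)

lemma l2_cinner_summable:
  fixes f g :: "'i \<Rightarrow> 'a::complex_inner"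
  assumes "(\<lambda>i. (norm (f i))\<^sup>2) summable_on UNIV" "(\<lambda>i. (norm (g i))\<^sup>2) summable_on UNIV"
  shows "(\<lambda>i. cinner (f i) (g i)) summable_on UNIV"
proof (rule abs_summable_summable, rule summable_on_comparison_test)
  show "(\<lambda>i. (norm (f i))\<^sup>2 + (norm (g i))\<^sup>2) summable_on UNIV"
    by (intro summable_on_add assms)
  show "norm (cinner (f i) (g i)) \<le> (norm (f i))\<^sup>2 + (norm (g i))\<^sup>2" for i
  proof -
    have "norm (cinner (f i) (g i)) \<le> norm (f i) * norm (g i)"
      by (rule cmod_cinner_le)
    also have "\<dots> \<le> (norm (f i))\<^sup>2 + (norm (g i))\<^sup>2"
    proof -
      have "0 \<le> (norm (f i) - norm (g i))\<^sup>2" "0 \<le> norm (f i) * norm (g i)" by simp_all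
      then show ?thesis unfolding power2_diff by linarith
    qed
    finally show ?thesis .
  qed
qed auto

instantiation l2 :: (type, complex_inner) complex_inner
begin

definition "0 = Abs_l2 (\<lambda>_. 0)"
definition "f + g = Abs_l2 (\<lambda>i. l2_coord f i + l2_coord g i)"
definition "c *\<^sub>C f = Abs_l2 (\<lambda>i. c *\<^sub>C l2_coord f i)"
definition "r *\<^sub>R f = complex_of_real r *\<^sub>C f" for f :: "('a, 'b) l2"
definition "- f = (-1) *\<^sub>C f" for f :: "('a, 'b) l2"
definition "f - g = f + - g" for f g :: "('a, 'b) l2"
definition "cinner f g = (\<Sum>\<^sub>\<infinity>i. cinner (l2_coord f i) (l2_coord g i))"
definition "inner f g = Re (cinner f g)" for f g :: "('a, 'b) l2"
definition "norm f = sqrt (inner f f)" for f :: "('a, 'b) l2"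
definition "sgn f = inverse (norm f) *\<^sub>R f" for f :: "('a, 'b) l2"
definition "dist f g = norm (f - g)" for f g :: "('a, 'b) l2"
definition uniformity_l2 :: "(('a, 'b) l2 \<times> ('a, 'b) l2) filter"
  where "uniformity_l2 = (INF e\<in>{0 <..}. principal {(x, y). dist x y < e})"
definition open_l2 :: "('a, 'b) l2 set \<Rightarrow> bool"
  where "open_l2 U = (\<forall>x\<in>U. \<forall>\<^sub>F (x', y) in uniformity. x' = x \<longrightarrow> y \<in> U)"

lemma l2_coord_zero [simp]: "l2_coord (0 :: ('a, 'b) l2) i = 0"
  by (simp add: zero_l2_def Abs_l2_inverse)

lemma l2_coord_add [simp]: "l2_coord (f + g :: ('a, 'b) l2) i = l2_coord f i + l2_coord g i"
  by (simp add: plus_l2_def Abs_l2_inverse l2_add_summable l2_summable)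

lemma l2_coord_scaleC [simp]: "l2_coord (c *\<^sub>C f :: ('a, 'b) l2) i = c *\<^sub>C l2_coord f i"
  by (simp add: scaleC_l2_def Abs_l2_inverse l2_scaleC_summable l2_summable)

lemma l2_coord_scaleR [simp]: "l2_coord (r *\<^sub>R f :: ('a, 'b) l2) i = r *\<^sub>R l2_coord f i"
  by (simp add: scaleR_l2_def scaleC_of_real)

lemma l2_coord_uminus [simp]: "l2_coord (- f :: ('a, 'b) l2) i = - l2_coord f i"
  by (simp add: uminus_l2_def)

lemma l2_coord_diff [simp]: "l2_coord (f - g :: ('a, 'b) l2) i = l2_coord f i - l2_coord g i"
  by (simp add: minus_l2_def)

lemma l2_cinner_self:
  "cinner f f = of_real (\<Sum>\<^sub>\<infinity>i. (norm (l2_coord f i))\<^sup>2)" for f :: "('a, 'b) l2"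
  unfolding cinner_l2_def cinner_self
  by (intro infsumI has_sum_of_real has_sum_infsum l2_summable)

instance
proof
  fix f g h :: "('a, 'b) l2" and c d :: complex and r s :: real
  note summ = l2_cinner_summable[OF l2_summable l2_summable]
  show "f + g + h = f + (g + h)" "f + g = g + f" "0 + f = f" "- f + f = 0" "f - g = f + - g"
    "r *\<^sub>R (f + g) = r *\<^sub>R f + r *\<^sub>R g" "(r + s) *\<^sub>R f = r *\<^sub>R f + s *\<^sub>R f"
    "r *\<^sub>R s *\<^sub>R f = (r * s) *\<^sub>R f" "1 *\<^sub>R f = f"
    "c *\<^sub>C (f + g) = c *\<^sub>C f + c *\<^sub>C g" "(c + d) *\<^sub>C f = c *\<^sub>C f + d *\<^sub>C f"
    "c *\<^sub>C d *\<^sub>C f = (c * d) *\<^sub>C f" "complex_of_real r *\<^sub>C f = r *\<^sub>R f"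
    by (rule l2_eqI; simp add: algebra_simps scaleC_of_real)+
  show "sgn f = inverse (norm f) *\<^sub>R f" "dist f g = norm (f - g)" "norm f = sqrt (inner f f)"
    "inner f g = Re (cinner f g)"
    by (simp_all add: sgn_l2_def dist_l2_def norm_l2_def inner_l2_def)
  show "uniformity = (INF e\<in>{0 <..}. principal {(x, y :: ('a, 'b) l2). dist x y < e})"
    by (rule uniformity_l2_def)
  show "open U = (\<forall>x\<in>U. \<forall>\<^sub>F (x', y) in uniformity. x' = x \<longrightarrow> y \<in> U)" for U :: "('a, 'b) l2 set"
    by (rule open_l2_def)
  show comm: "cinner f g = cnj (cinner g f)" for f g :: "('a, 'b) l2"
    unfolding cinner_l2_def infsum_cnj[symmetric] by (intro infsum_cong cinner_commute)
  show add: "cinner (f + g) h = cinner f h + cinner g h"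
    by (simp add: cinner_l2_def cinner_add_left infsum_add summ)
  show scaleC: "cinner (c *\<^sub>C f) g = c * cinner f g" for c
    by (simp add: cinner_l2_def cinner_scaleC_left infsum_cmult_right')
  show "inner f g = inner g f"
    by (subst inner_l2_def, subst comm) (simp add: inner_l2_def)
  show "inner (f + g) h = inner f h + inner g h"
    by (simp add: inner_l2_def add)
  show "inner (r *\<^sub>R f) g = r * inner f g"
    by (simp add: inner_l2_def scaleR_l2_def scaleC)
  show "0 \<le> inner f f"
    by (simp add: inner_l2_def l2_cinner_self infsum_nonneg)
  show "inner f f = 0 \<longleftrightarrow> f = 0"
  proof
    assume "inner f f = 0"
    then have "(\<Sum>\<^sub>\<infinity>i. (norm (l2_coord f i))\<^sup>2) = 0"
      by (simp add: inner_l2_def l2_cinner_self)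
    then have "(norm (l2_coord f i))\<^sup>2 = 0" for i
      by (intro nonneg_infsum_le_0D[where f = "\<lambda>i. (norm (l2_coord f i))\<^sup>2" and A = UNIV])
         (auto simp: l2_summable)
    then show "f = 0" by (intro l2_eqI) simp
  qed (simp add: inner_l2_def cinner_l2_def cinner_self)
qed

end

lemma l2_norm_sq: "(norm f)\<^sup>2 = (\<Sum>\<^sub>\<infinity>i. (norm (l2_coord f i))\<^sup>2)"
  using cinner_self[of f] unfolding l2_cinner_self of_real_eq_iff by simp

lemma l2_sum_le_norm: "finite F \<Longrightarrow> (\<Sum>i\<in>F. (norm (l2_coord f i))\<^sup>2) \<le> (norm f)\<^sup>2"
  unfolding l2_norm_sq by (rule finite_sum_le_infsum) (auto simp: l2_summable)

lemma l2_norm_coord_le: "norm (l2_coord f i) \<le> norm f"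
  using l2_sum_le_norm[of "{i}" f] by (simp add: power2_le_iff_abs_le)

instance l2 :: (type, chilbert_space) chilbert_space
proof
  fix X :: "nat \<Rightarrow> ('a, 'b) l2"
  assume X: "Cauchy X"
  have "Cauchy (\<lambda>n. l2_coord (X n) i)" for i
  proof (rule metric_CauchyI)
    fix e :: real assume "0 < e"
    then obtain N where N: "\<forall>m\<ge>N. \<forall>n\<ge>N. dist (X m) (X n) < e"
      using X by (auto simp: Cauchy_def)
    have "dist (l2_coord (X m) i) (l2_coord (X n) i) \<le> dist (X m) (X n)" for m n
      using l2_norm_coord_le[of "X m - X n" i] by (simp add: dist_norm)
    then show "\<exists>N. \<forall>m\<ge>N. \<forall>n\<ge>N. dist (l2_coord (X m) i) (l2_coord (X n) i) < e"
      using N by (meson le_less_trans)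
  qed
  then have "\<forall>i. \<exists>l. (\<lambda>n. l2_coord (X n) i) \<longlonglongrightarrow> l"
    by (simp add: Cauchy_convergent_iff convergent_def)
  then obtain L where L: "\<And>i. (\<lambda>n. l2_coord (X n) i) \<longlonglongrightarrow> L i" by metis
  have fin: "(\<Sum>i\<in>F. (norm (l2_coord (X m) i - L i))\<^sup>2) \<le> e\<^sup>2"
    if "finite F" "m \<ge> N" "\<forall>m\<ge>N. \<forall>n\<ge>N. dist (X m) (X n) < e" for F m N e
  proof (rule LIMSEQ_le_const2)
    show "(\<lambda>n. \<Sum>i\<in>F. (norm (l2_coord (X m) i - l2_coord (X n) i))\<^sup>2)
      \<longlonglongrightarrow> (\<Sum>i\<in>F. (norm (l2_coord (X m) i - L i))\<^sup>2)"
      by (intro tendsto_intros L)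
    show "\<exists>K. \<forall>n\<ge>K. (\<Sum>i\<in>F. (norm (l2_coord (X m) i - l2_coord (X n) i))\<^sup>2) \<le> e\<^sup>2"
    proof (intro exI allI impI)
      fix n assume "n \<ge> N"
      have "(\<Sum>i\<in>F. (norm (l2_coord (X m) i - l2_coord (X n) i))\<^sup>2) \<le> (norm (X m - X n))\<^sup>2"
        using l2_sum_le_norm[OF that(1), of "X m - X n"] by simp
      also have "\<dots> \<le> e\<^sup>2"
        using that(2,3) \<open>n \<ge> N\<close> by (intro power_mono) (auto simp: dist_norm less_imp_le)
      finally show "(\<Sum>i\<in>F. (norm (l2_coord (X m) i - l2_coord (X n) i))\<^sup>2) \<le> e\<^sup>2" .
    qed
  qed
  have diff: "(\<lambda>i. (norm (l2_coord (X m) i - L i))\<^sup>2) summable_on UNIV"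
    "(\<Sum>\<^sub>\<infinity>i. (norm (l2_coord (X m) i - L i))\<^sup>2) \<le> e\<^sup>2"
    if "m \<ge> N" "\<forall>m\<ge>N. \<forall>n\<ge>N. dist (X m) (X n) < e" for m N e
  proof -
    show *: "(\<lambda>i. (norm (l2_coord (X m) i - L i))\<^sup>2) summable_on UNIV"
      by (rule nonneg_bdd_above_summable_on) (auto simp: bdd_above_def intro!: fin[OF _ that])
    show "(\<Sum>\<^sub>\<infinity>i. (norm (l2_coord (X m) i - L i))\<^sup>2) \<le> e\<^sup>2"
      by (rule infsum_le_finite_sums[OF *]) (auto intro!: fin[OF _ that])
  qed
  obtain N1 where N1: "\<forall>m\<ge>N1. \<forall>n\<ge>N1. dist (X m) (X n) < 1"
    using X unfolding Cauchy_def by (meson zero_less_one)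
  have "(\<lambda>i. (norm (l2_coord (X N1) i + (-1) *\<^sub>C (l2_coord (X N1) i - L i)))\<^sup>2) summable_on UNIV"
    by (intro l2_add_summable l2_scaleC_summable l2_summable diff(1)[OF order_refl N1])
  then have Lsum: "(\<lambda>i. (norm (L i))\<^sup>2) summable_on UNIV"
    by (simp add: complex_vector.scale_minus_left)
  define Y where "Y = Abs_l2 L"
  have Y: "l2_coord Y = L"
    unfolding Y_def using Lsum by (simp add: Abs_l2_inverse)
  have "X \<longlonglongrightarrow> Y"
  proof (rule metric_LIMSEQ_I)
    fix e :: real assume "0 < e"
    then obtain N where N: "\<forall>m\<ge>N. \<forall>n\<ge>N. dist (X m) (X n) < e / 2"
      using X unfolding Cauchy_def by (meson half_gt_zero)
    have "dist (X m) Y < e" if "m \<ge> N" for m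
    proof -
      have "(norm (X m - Y))\<^sup>2 \<le> (e / 2)\<^sup>2"
        using diff(2)[OF that N] by (simp add: l2_norm_sq Y)
      then have "norm (X m - Y) \<le> e / 2"
        using \<open>0 < e\<close> by (simp add: power2_le_iff_abs_le)
      then show ?thesis using \<open>0 < e\<close> by (simp add: dist_norm)
    qed
    then show "\<exists>N. \<forall>m\<ge>N. dist (X m) Y < e" by blast
  qed
  then show "convergent X" by (auto simp: convergent_def)
qed

subsection \<open>Bounded operators\<close>

definition bounded_clinear :: "('a::complex_inner \<Rightarrow> 'b::complex_inner) \<Rightarrow> bool" where
  "bounded_clinear A \<longleftrightarrow> bounded_linear A \<and> (\<forall>c x. A (c *\<^sub>C x) = c *\<^sub>C A x)"

definition cadjoint :: "('a::complex_inner \<Rightarrow> 'b::complex_inner) \<Rightarrow> 'b \<Rightarrow> 'a" where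
  "cadjoint A = (THE B. \<forall>x y. cinner (A x) y = cinner x (B y))"

definition nonneg_op :: "('a::complex_inner \<Rightarrow> 'a) \<Rightarrow> bool" where
  "nonneg_op A \<longleftrightarrow> (\<forall>x. cinner (A x) x \<in> \<real>\<^sub>\<ge>\<^sub>0)"

text \<open>Convergence of operator series in the weak operator topology.\<close>

definition wot_sums :: "(nat \<Rightarrow> 'a::complex_inner \<Rightarrow> 'a) \<Rightarrow> ('a \<Rightarrow> 'a) \<Rightarrow> bool" where
  "wot_sums F A \<longleftrightarrow> bounded_clinear A \<and> (\<forall>x y. (\<lambda>k. cinner (F k x) y) sums cinner (A x) y)"

definition wot_summable :: "(nat \<Rightarrow> 'a::complex_inner \<Rightarrow> 'a) \<Rightarrow> bool" where
  "wot_summable F \<longleftrightarrow> (\<exists>A. wot_sums F A)"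

definition wot_suminf :: "(nat \<Rightarrow> 'a::complex_inner \<Rightarrow> 'a) \<Rightarrow> 'a \<Rightarrow> 'a" where
  "wot_suminf F = (THE A. wot_sums F A)"

subsection \<open>Formal power series in noncommuting indeterminates\<close>

text \<open>The free semigroup on the generators indexed by \<^typ>\<open>'n\<close> is the type of lists over
  \<^typ>\<open>'n\<close>; a formal power series is the family of its coefficients. Below \<open>n\<close> is the
  cardinality of the finite, nonempty index type \<^typ>\<open>'n\<close>.\<close>

definition nc_one :: "'n list \<Rightarrow> real" where
  "nc_one \<gamma> = (if \<gamma> = [] then 1 else 0)"

definition nc_mult :: "('n list \<Rightarrow> real) \<Rightarrow> ('n list \<Rightarrow> real) \<Rightarrow> 'n list \<Rightarrow> real" where
  "nc_mult f g \<gamma> = (\<Sum>(\<alpha>, \<beta>) | \<alpha> @ \<beta> = \<gamma>. f \<alpha> * g \<beta>)"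

definition nc_inverse :: "('n list \<Rightarrow> real) \<Rightarrow> 'n list \<Rightarrow> real" where
  "nc_inverse f = (THE g. nc_mult f g = nc_one \<and> nc_mult g f = nc_one)"

lemma nc_mult_take_drop:
  "nc_mult f g \<gamma> = (\<Sum>k\<le>length \<gamma>. f (take k \<gamma>) * g (drop k \<gamma>))"
  unfolding nc_mult_def
  by (rule sum.reindex_bij_witness[where i = "\<lambda>k. (take k \<gamma>, drop k \<gamma>)" and j = "\<lambda>(\<alpha>, \<beta>). length \<alpha>"])
     auto

lemma nc_mult_assoc: "nc_mult (nc_mult f g) h = nc_mult f (nc_mult g h)"
proof
  fix \<gamma> :: "'a list"
  have fin: "finite {(\<alpha>, \<beta>). \<alpha> @ \<beta> = \<gamma>}" for \<gamma> :: "'a list"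
  proof (rule finite_subset)
    show "{(\<alpha>, \<beta>). \<alpha> @ \<beta> = \<gamma>} \<subseteq> (\<lambda>k. (take k \<gamma>, drop k \<gamma>)) ` {..length \<gamma>}"
    proof clarify
      fix \<alpha> \<beta> assume "\<gamma> = \<alpha> @ \<beta>"
      then show "(\<alpha>, \<beta>) \<in> (\<lambda>k. (take k (\<alpha> @ \<beta>), drop k (\<alpha> @ \<beta>))) ` {..length (\<alpha> @ \<beta>)}"
        by (intro image_eqI[where x = "length \<alpha>"]) auto
    qed
  qed simp
  have "nc_mult (nc_mult f g) h \<gamma> =
    (\<Sum>x\<in>{(\<alpha>, \<beta>). \<alpha> @ \<beta> = \<gamma>}. \<Sum>y\<in>{(\<alpha>, \<beta>). \<alpha> @ \<beta> = fst x}. f (fst y) * g (snd y) * h (snd x))"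
    by (simp add: nc_mult_def sum_distrib_right case_prod_unfold)
  also have "\<dots> =
    (\<Sum>x\<in>{(\<alpha>, \<beta>). \<alpha> @ \<beta> = \<gamma>}. \<Sum>y\<in>{(\<alpha>, \<beta>). \<alpha> @ \<beta> = snd x}. f (fst x) * (g (fst y) * h (snd y)))"
    by (simp add: sum.Sigma fin,
        rule sum.reindex_bij_witness[where
          i = "\<lambda>(x, y). ((fst x @ fst y, snd y), (fst x, fst y))" and
          j = "\<lambda>(x, y). ((fst y, snd y @ snd x), (snd y, snd x))"])
       (auto simp: mult.assoc)
  also have "\<dots> = nc_mult f (nc_mult g h) \<gamma>"
    by (simp add: nc_mult_def sum_distrib_left case_prod_unfold)
  finally show "nc_mult (nc_mult f g) h \<gamma> = nc_mult f (nc_mult g h) \<gamma>" .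
qed

lemma nc_mult_one_right: "nc_mult f nc_one = f"
proof
  fix \<gamma>
  have "nc_mult f nc_one \<gamma> = (\<Sum>k\<le>length \<gamma>. if k = length \<gamma> then f \<gamma> else 0)"
    unfolding nc_mult_take_drop by (rule sum.cong) (auto simp: nc_one_def)
  then show "nc_mult f nc_one \<gamma> = f \<gamma>" by simp
qed

lemma nc_mult_one_left: "nc_mult nc_one f = f"
proof
  fix \<gamma>
  have "nc_mult nc_one f \<gamma> = (\<Sum>k\<le>length \<gamma>. if k = 0 then f \<gamma> else 0)"
    unfolding nc_mult_take_drop by (rule sum.cong) (auto simp: nc_one_def)
  then show "nc_mult nc_one f \<gamma> = f \<gamma>" by simp
qed

fun nc_right_inv :: "('n list \<Rightarrow> real) \<Rightarrow> 'n list \<Rightarrow> real" where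
  "nc_right_inv f \<gamma> = (if \<gamma> = [] then 1 else
     - (\<Sum>k<length \<gamma>. f (take (Suc k) \<gamma>) * nc_right_inv f (drop (Suc k) \<gamma>)))"

fun nc_left_inv :: "('n list \<Rightarrow> real) \<Rightarrow> 'n list \<Rightarrow> real" where
  "nc_left_inv f \<gamma> = (if \<gamma> = [] then 1 else
     - (\<Sum>k<length \<gamma>. nc_left_inv f (take k \<gamma>) * f (drop k \<gamma>)))"

declare nc_right_inv.simps [simp del] nc_left_inv.simps [simp del]

lemma nc_inverse_correct:
  assumes "f [] = 1"
  shows "nc_mult f (nc_inverse f) = nc_one" "nc_mult (nc_inverse f) f = nc_one"
proof -
  have R: "nc_mult f (nc_right_inv f) = nc_one"
  proof
    fix \<gamma>
    have "nc_mult f (nc_right_inv f) \<gamma> = nc_right_inv f \<gamma>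
        + (\<Sum>k<length \<gamma>. f (take (Suc k) \<gamma>) * nc_right_inv f (drop (Suc k) \<gamma>))"
      unfolding nc_mult_take_drop by (subst sum.atMost_shift) (simp add: assms)
    then show "nc_mult f (nc_right_inv f) \<gamma> = nc_one \<gamma>"
      using nc_right_inv.simps[of f \<gamma>] by (cases "\<gamma> = []") (simp_all add: nc_one_def)
  qed
  have L: "nc_mult (nc_left_inv f) f = nc_one"
  proof
    fix \<gamma>
    have "nc_mult (nc_left_inv f) f \<gamma>
      = (\<Sum>k<length \<gamma>. nc_left_inv f (take k \<gamma>) * f (drop k \<gamma>)) + nc_left_inv f \<gamma>"
      unfolding nc_mult_take_drop by (simp add: lessThan_Suc_atMost[symmetric] assms)
    then show "nc_mult (nc_left_inv f) f \<gamma> = nc_one \<gamma>"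
      using nc_left_inv.simps[of f \<gamma>] by (cases "\<gamma> = []") (simp_all add: nc_one_def)
  qed
  have eq: "g = nc_left_inv f" if "nc_mult f g = nc_one" for g
    by (metis L nc_mult_assoc nc_mult_one_left nc_mult_one_right that)
  have "nc_right_inv f = nc_left_inv f"
    by (rule eq[OF R])
  then have "\<exists>!g. nc_mult f g = nc_one \<and> nc_mult g f = nc_one"
    using R L eq by metis
  then have "nc_mult f (nc_inverse f) = nc_one \<and> nc_mult (nc_inverse f) f = nc_one"
    unfolding nc_inverse_def by (rule theI')
  then show "nc_mult f (nc_inverse f) = nc_one" "nc_mult (nc_inverse f) f = nc_one" by auto
qed

subsection \<open>Hilbert tensor products with an \<open>l2\<close> space\<close>

text \<open>The space of square-summable families in \<open>\<G>\<close> is the Hilbert tensor product of the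
  space of square-summable families of complex numbers with \<open>\<G>\<close>: the elementary tensors below
  satisfy \<open>\<langle>\<phi> \<otimes> x, \<psi> \<otimes> y\<rangle> = \<langle>\<phi>, \<psi>\<rangle> \<langle>x, y\<rangle>\<close> and have dense span.\<close>

definition l2_tensor :: "('i, complex) l2 \<Rightarrow> 'a::complex_inner \<Rightarrow> ('i, 'a) l2"  (infixr "\<otimes>\<^sub>2" 70) where
  "\<phi> \<otimes>\<^sub>2 x = Abs_l2 (\<lambda>i. l2_coord \<phi> i *\<^sub>C x)"

text \<open>\<open>\<G>\<close> is a closed subspace of an ambient Hilbert space, so that a Hilbert space can be
  existentially quantified without quantifying over types.\<close>

definition closed_csubspace :: "'a::complex_inner set \<Rightarrow> bool" where
  "closed_csubspace \<G> \<longleftrightarrow> complex_vector.subspace \<G> \<and> closed \<G>"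

definition tensor_space :: "'a::complex_inner set \<Rightarrow> ('i, 'a) l2 set" where
  "tensor_space \<G> = closure (complex_vector.span {\<phi> \<otimes>\<^sub>2 x | \<phi> x. x \<in> \<G>})"

text \<open>The operator \<open>A \<otimes> I\<close>; it maps \<open>tensor_space \<G>\<close> into itself and restricts there to
  \<open>A \<otimes> I\<^sub>\<G>\<close>.\<close>

definition ampliation ::
  "(('i, complex) l2 \<Rightarrow> ('i, complex) l2) \<Rightarrow> ('i, 'a::complex_inner) l2 \<Rightarrow> ('i, 'a) l2" where
  "ampliation A = (THE B. bounded_clinear B \<and> (\<forall>\<phi> x. B (\<phi> \<otimes>\<^sub>2 x) = A \<phi> \<otimes>\<^sub>2 x))"

lemma l2_coord_tensor [simp]: "l2_coord (\<phi> \<otimes>\<^sub>2 x) i = l2_coord \<phi> i *\<^sub>C x"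
proof -
  have "(\<lambda>i. (norm (l2_coord \<phi> i *\<^sub>C x))\<^sup>2) summable_on UNIV"
    by (simp add: norm_scaleC power_mult_distrib summable_on_cmult_left l2_summable)
  then show ?thesis by (simp add: l2_tensor_def Abs_l2_inverse)
qed

lemma cinner_tensor: "cinner (\<phi> \<otimes>\<^sub>2 x) (\<psi> \<otimes>\<^sub>2 y) = cinner \<phi> \<psi> * cinner x y"
proof -
  have "cinner (\<phi> \<otimes>\<^sub>2 x) (\<psi> \<otimes>\<^sub>2 y) =
    (\<Sum>\<^sub>\<infinity>i. cinner (l2_coord \<phi> i) (l2_coord \<psi> i) * cinner x y)"
    unfolding cinner_l2_def
    by (intro infsum_cong)
       (simp add: cinner_scaleC_left cinner_scaleC_right cinner_complex_def)
  then show ?thesis by (simp add: infsum_cmult_left' cinner_l2_def)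
qed

definition l2_unit :: "'i \<Rightarrow> ('i, complex) l2" where
  "l2_unit i = Abs_l2 (\<lambda>j. if j = i then 1 else 0)"

lemma l2_coord_unit [simp]: "l2_coord (l2_unit i) j = (if j = i then 1 else 0)"
proof -
  have "(\<lambda>j. (norm (if j = i then 1 else 0 :: complex))\<^sup>2) summable_on UNIV"
    by (rule summable_on_cong_neutral[where S = "{i}", THEN iffD1]) auto
  then show ?thesis by (simp add: l2_unit_def Abs_l2_inverse)
qed

lemma tensor_space_eq:
  fixes \<G> :: "'a::complex_inner set"
  assumes "closed_csubspace \<G>"
  shows "(tensor_space \<G> :: ('i, 'a) l2 set) = {f. \<forall>i. l2_coord f i \<in> \<G>}"
proof
  have sub: "complex_vector.subspace \<G>" and cl: "closed \<G>"
    using assms by (auto simp: closed_csubspace_def)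
  have "closed {f :: ('i, 'a) l2. l2_coord f i \<in> \<G>}" for i
  proof -
    have "bounded_linear (\<lambda>f :: ('i, 'a) l2. l2_coord f i)"
      by (rule bounded_linear_intro[where K = 1]) (simp_all add: l2_norm_coord_le)
    then show ?thesis
      using continuous_closed_preimage[OF linear_continuous_on closed_UNIV cl]
      by (simp add: vimage_def)
  qed
  then have "closed {f :: ('i, 'a) l2. \<forall>i. l2_coord f i \<in> \<G>}"
    by (simp add: Collect_all_eq closed_INT)
  moreover have "complex_vector.span {\<phi> \<otimes>\<^sub>2 x | \<phi> x. x \<in> \<G>} \<subseteq> {f :: ('i, 'a) l2. \<forall>i. l2_coord f i \<in> \<G>}"
    by (rule complex_vector.span_minimal)
       (use sub in \<open>auto simp: complex_vector.subspace_def\<close>)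
  ultimately show "tensor_space \<G> \<subseteq> {f :: ('i, 'a) l2. \<forall>i. l2_coord f i \<in> \<G>}"
    unfolding tensor_space_def by (rule closure_minimal[rotated])
  show "{f :: ('i, 'a) l2. \<forall>i. l2_coord f i \<in> \<G>} \<subseteq> tensor_space \<G>"
  proof
    fix f :: "('i, 'a) l2" assume "f \<in> {f. \<forall>i. l2_coord f i \<in> \<G>}"
    then have f: "l2_coord f i \<in> \<G>" for i by simp
    show "f \<in> tensor_space \<G>"
      unfolding tensor_space_def closure_approachable
    proof (intro allI impI)
      fix e :: real assume "0 < e"
      have "((\<lambda>i. (norm (l2_coord f i))\<^sup>2) has_sum (norm f)\<^sup>2) UNIV"
        unfolding l2_norm_sq by (rule has_sum_infsum[OF l2_summable])
      then obtain F where F: "finite F"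
        "dist (\<Sum>i\<in>F. (norm (l2_coord f i))\<^sup>2) ((norm f)\<^sup>2) < e\<^sup>2"
        using \<open>0 < e\<close> unfolding has_sum_def tendsto_iff eventually_finite_subsets_at_top
        by (metis order_refl subset_UNIV zero_less_power)
      define g where "g = (\<Sum>i\<in>F. l2_unit i \<otimes>\<^sub>2 l2_coord f i)"
      have coord_sum: "l2_coord (\<Sum>i\<in>A. h i) j = (\<Sum>i\<in>A. l2_coord (h i) j)"
        if "finite A" for A j and h :: "'i \<Rightarrow> ('i, 'a) l2"
        using that by induction auto
      have g: "l2_coord g j = (if j \<in> F then l2_coord f j else 0)" for j
      proof -
        have "l2_coord g j = (\<Sum>i\<in>F. if j = i then l2_coord f j else 0)"
          unfolding g_def coord_sum[OF F(1)] by (rule sum.cong) auto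
        then show ?thesis using F(1) by simp
      qed
      have "(norm (g - f))\<^sup>2 = (\<Sum>\<^sub>\<infinity>i\<in>UNIV - F. (norm (l2_coord f i))\<^sup>2)"
        unfolding l2_norm_sq by (rule infsum_cong_neutral) (auto simp: g)
      also have "\<dots> = (norm f)\<^sup>2 - (\<Sum>i\<in>F. (norm (l2_coord f i))\<^sup>2)"
        unfolding l2_norm_sq
        by (subst infsum_Diff) (auto simp: l2_summable F(1) intro: summable_on_finite)
      also have "\<dots> < e\<^sup>2"
        using F(2) by (simp add: dist_real_def)
      finally have "dist g f < e"
        using \<open>0 < e\<close> by (simp add: dist_norm power2_less_imp_less)
      moreover have "g \<in> complex_vector.span {\<phi> \<otimes>\<^sub>2 x | \<phi> x. x \<in> \<G>}"
        unfolding g_def by (intro complex_vector.span_sum complex_vector.span_base) (use f in blast)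
      ultimately show "\<exists>y\<in>complex_vector.span {\<phi> \<otimes>\<^sub>2 x | \<phi> x. x \<in> \<G>}. dist y f < e" by blast
    qed
  qed
qed

lemma ampliation_eqI:
  fixes B :: "('i, 'a::complex_inner) l2 \<Rightarrow> ('i, 'a) l2"
  assumes "bounded_clinear B" and B: "\<And>\<phi> x. B (\<phi> \<otimes>\<^sub>2 x) = A \<phi> \<otimes>\<^sub>2 x"
  shows "ampliation A = B"
  unfolding ampliation_def
proof (rule the_equality)
  fix C :: "('i, 'a) l2 \<Rightarrow> ('i, 'a) l2"
  assume C: "bounded_clinear C \<and> (\<forall>\<phi> x. C (\<phi> \<otimes>\<^sub>2 x) = A \<phi> \<otimes>\<^sub>2 x)"
  then have lin: "bounded_linear B" "bounded_linear C" "\<And>c x. B (c *\<^sub>C x) = c *\<^sub>C B x"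
      "\<And>c x. C (c *\<^sub>C x) = c *\<^sub>C C x"
    using assms(1) by (auto simp: bounded_clinear_def)
  have "closed {f. C f = B f}"
    using lin by (intro closed_Collect_eq linear_continuous_on)
  moreover have "complex_vector.span {\<phi> \<otimes>\<^sub>2 x | \<phi> x. x \<in> (UNIV :: 'a set)} \<subseteq> {f. C f = B f}"
    by (rule complex_vector.span_minimal)
       (use B C lin in \<open>auto simp: complex_vector.subspace_def
          linear_add[OF bounded_linear.linear] linear_0[OF bounded_linear.linear]\<close>)
  ultimately have "tensor_space UNIV \<subseteq> {f. C f = B f}"
    unfolding tensor_space_def by (rule closure_minimal[rotated])
  moreover have "tensor_space (UNIV :: 'a set) = (UNIV :: ('i, 'a) l2 set)"
    by (subst tensor_space_eq) (auto simp: closed_csubspace_def)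
  ultimately show "C = B" by blast
qed (use assms in blast)

subsection \<open>The full Fock space and the universal model\<close>

text \<open>The words of length \<open>k\<close> index the orthonormal basis \<open>e\<^sub>\<alpha>\<close> of the \<open>k\<close>-th tensor
  power of \<open>H\<^sub>n\<close>, so the full Fock space is \<open>l2\<close> over the free semigroup, with
  \<open>e\<^sub>\<alpha>\<close> being \<^term>\<open>l2_unit \<alpha>\<close>.\<close>

type_synonym 'n fock = "('n list, complex) l2"

definition left_creation :: "'n \<Rightarrow> 'n fock \<Rightarrow> 'n fock" where
  "left_creation i \<phi> =
    Abs_l2 (\<lambda>\<gamma>. case \<gamma> of [] \<Rightarrow> 0 | j # \<alpha> \<Rightarrow> if j = i then l2_coord \<phi> \<alpha> else 0)"

definition weight_op :: "('n list \<Rightarrow> real) \<Rightarrow> 'n \<Rightarrow> 'n fock \<Rightarrow> 'n fock" where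
  "weight_op b i \<phi> = Abs_l2 (\<lambda>\<alpha>. of_real (sqrt (b \<alpha> / b (i # \<alpha>))) * l2_coord \<phi> \<alpha>)"

definition universal_model :: "('n list \<Rightarrow> real) \<Rightarrow> 'n \<Rightarrow> 'n fock \<Rightarrow> 'n fock" where
  "universal_model b i = left_creation i \<circ> weight_op b i"

lemma left_creation_unit: "left_creation i (l2_unit \<alpha>) = l2_unit (i # \<alpha>)"
  unfolding left_creation_def l2_unit_def[of "i # \<alpha>"]
  by (rule arg_cong[where f = Abs_l2]) (auto split: list.split)

lemma weight_op_unit: "weight_op b i (l2_unit \<alpha>) = sqrt (b \<alpha> / b (i # \<alpha>)) *\<^sub>R l2_unit \<alpha>"
  unfolding weight_op_def scaleR_l2_def scaleC_l2_def
  by (rule arg_cong[where f = Abs_l2]) (auto simp: scaleC_complex_def)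

lemma l2_coord_left_creation:
  "l2_coord (left_creation i \<phi>) \<gamma> =
    (case \<gamma> of [] \<Rightarrow> 0 | j # \<alpha> \<Rightarrow> if j = i then l2_coord \<phi> \<alpha> else 0)"
proof -
  let ?f = "\<lambda>\<gamma>. case \<gamma> of [] \<Rightarrow> 0 | j # \<alpha> \<Rightarrow> if j = i then l2_coord \<phi> \<alpha> else 0"
  have "((\<lambda>\<gamma>. (norm (?f \<gamma>))\<^sup>2) \<circ> (#) i) summable_on UNIV"
    by (simp add: o_def l2_summable)
  then have "(\<lambda>\<gamma>. (norm (?f \<gamma>))\<^sup>2) summable_on range ((#) i)"
    by (subst summable_on_reindex) auto
  then have "(\<lambda>\<gamma>. (norm (?f \<gamma>))\<^sup>2) summable_on UNIV"
    by (rule summable_on_cong_neutral[THEN iffD1, rotated 3]) (auto split: list.splits)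
  then show ?thesis by (simp add: left_creation_def Abs_l2_inverse)
qed

lemma l2_coord_weight_op:
  assumes "\<And>\<alpha>. 0 < b \<alpha>" "bdd_above (range (\<lambda>\<alpha>. b \<alpha> / b (i # \<alpha>)))"
  shows "l2_coord (weight_op b i \<phi>) \<alpha> = of_real (sqrt (b \<alpha> / b (i # \<alpha>))) * l2_coord \<phi> \<alpha>"
proof -
  obtain K where K: "b \<alpha> / b (i # \<alpha>) \<le> K" for \<alpha>
    using assms(2) by (auto simp: bdd_above_def)
  have "(\<lambda>\<alpha>. (norm (of_real (sqrt (b \<alpha> / b (i # \<alpha>))) * l2_coord \<phi> \<alpha>))\<^sup>2) summable_on UNIV"
  proof (rule summable_on_comparison_test)
    show "(\<lambda>\<alpha>. K * (norm (l2_coord \<phi> \<alpha>))\<^sup>2) summable_on UNIV"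
      by (intro summable_on_cmult_right l2_summable)
    show "(norm (of_real (sqrt (b \<alpha> / b (i # \<alpha>))) * l2_coord \<phi> \<alpha>))\<^sup>2
        \<le> K * (norm (l2_coord \<phi> \<alpha>))\<^sup>2" for \<alpha>
      using mult_right_mono[OF K[of \<alpha>], of "(norm (l2_coord \<phi> \<alpha>))\<^sup>2"]
        assms(1)[of \<alpha>] assms(1)[of "i # \<alpha>"]
      by (simp add: norm_mult power_mult_distrib)
  qed auto
  then show ?thesis by (simp add: weight_op_def Abs_l2_inverse)
qed

primrec op_word :: "('n \<Rightarrow> 'a \<Rightarrow> 'a) \<Rightarrow> 'n list \<Rightarrow> 'a \<Rightarrow> 'a" where
  "op_word X [] = id"
| "op_word X (i # \<alpha>) = X i \<circ> op_word X \<alpha>"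

text \<open>The homogeneous block \<open>\<Sum>\<^bsub>|\<alpha>|=k\<^esub> c\<^sub>\<alpha> X\<^sub>\<alpha> Y X\<^sub>\<alpha>\<^sup>*\<close>.\<close>

definition hom_block ::
  "('n::finite list \<Rightarrow> real) \<Rightarrow> ('n \<Rightarrow> 'a::complex_inner \<Rightarrow> 'a) \<Rightarrow> ('a \<Rightarrow> 'a) \<Rightarrow> nat \<Rightarrow> 'a \<Rightarrow> 'a" where
  "hom_block c X Y k = (\<lambda>x. \<Sum>\<alpha> | length \<alpha> = k. c \<alpha> *\<^sub>R op_word X \<alpha> (Y (cadjoint (op_word X \<alpha>) x)))"

definition admissible :: "('n::finite list \<Rightarrow> real) \<Rightarrow> bool" where
  "admissible b \<longleftrightarrow>
    b [] = 1 \<and> (\<forall>\<alpha>. 0 < b \<alpha>) \<and> (\<forall>i. bdd_above (range (\<lambda>\<alpha>. b \<alpha> / b (i # \<alpha>)))) \<and>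
    limsup (\<lambda>k. ereal ((\<Sum>\<alpha> | length \<alpha> = k. (b \<alpha>)\<^sup>2) powr (1 / (2 * real k)))) < \<infinity> \<and>
    bdd_above (range (\<lambda>k. onorm
      (\<lambda>\<phi>. \<Sum>p\<le>k. hom_block (nc_inverse b) (universal_model b) id p \<phi>)))"

subsection \<open>Noncommutative domains, pure tuples and dilations\<close>

definition defect :: "('n::finite list \<Rightarrow> real) \<Rightarrow> ('n \<Rightarrow> 'a::complex_inner \<Rightarrow> 'a) \<Rightarrow> 'a \<Rightarrow> 'a" where
  "defect b X = wot_suminf (hom_block (nc_inverse b) X id)"

definition nc_domain :: "('n::finite list \<Rightarrow> real) \<Rightarrow> ('n \<Rightarrow> 'a::complex_inner \<Rightarrow> 'a) set" where
  "nc_domain b = {X. (\<forall>i. bounded_clinear (X i)) \<and>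
    wot_summable (hom_block (nc_inverse b) X id) \<and> nonneg_op (defect b X) \<and>
    wot_summable (hom_block b X (defect b X)) \<and>
    nonneg_op (\<lambda>x. x - wot_suminf (hom_block b X (defect b X)) x)}"

definition pure_tuple :: "('n::finite list \<Rightarrow> real) \<Rightarrow> ('n \<Rightarrow> 'a::complex_inner \<Rightarrow> 'a) \<Rightarrow> bool" where
  "pure_tuple b X \<longleftrightarrow> X \<in> nc_domain b \<and> wot_suminf (hom_block b X (defect b X)) = id"

definition is_dilation :: "('n::finite list \<Rightarrow> real) \<Rightarrow> ('n \<Rightarrow> 'h::complex_inner \<Rightarrow> 'h) \<Rightarrow>
    'a::complex_inner set \<Rightarrow> ('h \<Rightarrow> ('n list, 'a) l2) \<Rightarrow> bool" where
  "is_dilation b T \<G> V \<longleftrightarrow> closed_csubspace \<G> \<and>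
    bounded_clinear V \<and> (\<forall>h. norm (V h) = norm h) \<and> range V \<subseteq> tensor_space \<G> \<and>
    (\<forall>i h. V (cadjoint (T i) h) = ampliation (cadjoint (universal_model b i)) (V h))"

definition is_minimal_dilation :: "('n::finite list \<Rightarrow> real) \<Rightarrow> ('n \<Rightarrow> 'h::complex_inner \<Rightarrow> 'h) \<Rightarrow>
    'a::complex_inner set \<Rightarrow> ('h \<Rightarrow> ('n list, 'a) l2) \<Rightarrow> bool" where
  "is_minimal_dilation b T \<G> V \<longleftrightarrow> is_dilation b T \<G> V \<and>
    closure (complex_vector.span {ampliation (op_word (universal_model b) \<alpha>) (V h) | \<alpha> h. True})
      = tensor_space \<G>"

definition unitary_between :: "'a::complex_inner set \<Rightarrow> 'b::complex_inner set \<Rightarrow> ('a \<Rightarrow> 'b) \<Rightarrow> bool" where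
  "unitary_between M N U \<longleftrightarrow>
    (\<forall>x\<in>M. \<forall>y\<in>M. U (x + y) = U x + U y) \<and> (\<forall>c. \<forall>x\<in>M. U (c *\<^sub>C x) = c *\<^sub>C U x) \<and>
    (\<forall>x\<in>M. norm (U x) = norm x) \<and> U ` M = N"

definition isomorphic_dilations :: "('n list \<Rightarrow> real) \<Rightarrow>
    'a::complex_inner set \<Rightarrow> ('h \<Rightarrow> ('n list, 'a) l2) \<Rightarrow>
    'b::complex_inner set \<Rightarrow> ('h \<Rightarrow> ('n list, 'b) l2) \<Rightarrow> bool" where
  "isomorphic_dilations b \<G> V \<G>' V' \<longleftrightarrow>
    (\<exists>U. unitary_between (tensor_space \<G>) (tensor_space \<G>') U \<and>
      (\<forall>i. \<forall>f\<in>tensor_space \<G>. U (ampliation (universal_model b i) f)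
          = ampliation (universal_model b i) (U f)) \<and>
      (\<forall>h. U (V h) = V' h))"

end

theory Submission
  imports Defs
begin

text \<open>An isometry \<open>V\<close> that intertwines \<open>T\<^sub>i\<^sup>*\<close> with \<open>W\<^sub>i\<^sup>* \<otimes> I\<close> is determined by its vacuum
  component \<open>V\<^sub>0\<close>: the component at \<open>e\<^sub>\<alpha>\<close> is \<open>\<surd>b\<^sub>\<alpha> V\<^sub>0 T\<^sub>\<alpha>\<^sup>*\<close>. The partial sums of
  \<open>\<Sum> a\<^sub>\<alpha> W\<^sub>\<alpha> W\<^sub>\<alpha>\<^sup>*\<close> are diagonal, uniformly bounded by admissibility, and each diagonal entry is
  eventually that of the projection onto the vacuum, because \<open>g\<^sup>-\<^sup>1 g = 1\<close>. So they converge
  strongly to that projection, and compressing by \<open>V\<close> gives \<open>V\<^sub>0\<^sup>* V\<^sub>0 = \<Delta>\<close>, the defect operator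
  of \<open>T\<close>. Minimality says that \<open>V\<^sub>0\<close> has dense range in \<open>\<G>\<close>, so two minimal dilations are
  identified by the unitary \<open>V\<^sub>0 h \<mapsto> V\<^sub>0' h\<close>. Conversely \<open>V\<^sub>0 = \<Delta>\<^sup>1\<^sup>/\<^sup>2\<close> defines an isometry exactly
  because \<open>T\<close> is pure, and the same strong limit shows that this dilation is minimal.\<close>

section \<open>Bounded complex-linear maps and the complex inner product\<close>

instance chilbert_space \<subseteq> banach ..

lemma bounded_clinear_imp_linear: "bounded_clinear A \<Longrightarrow> linear A"
  by (simp add: bounded_clinear_def bounded_linear.linear)

lemma bounded_clinear_compose:
  "bounded_clinear A \<Longrightarrow> bounded_clinear B \<Longrightarrow> bounded_clinear (\<lambda>x. A (B x))"
  by (simp add: bounded_clinear_def bounded_linear_compose)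

lemma bounded_clinear_id: "bounded_clinear (\<lambda>x. x)"
  by (simp add: bounded_clinear_def bounded_linear_ident)

lemma scaleR_scaleC_commute: "r *\<^sub>R c *\<^sub>C x = c *\<^sub>C r *\<^sub>R x" for x :: "'a::complex_inner"
  by (simp add: scaleC_of_real[symmetric] scaleC_scaleC mult.commute)

lemma bounded_linear_scaleC: "bounded_linear (\<lambda>x :: 'a::complex_inner. c *\<^sub>C x)"
  by (rule bounded_linear_intro[where K = "cmod c"])
     (simp_all add: scaleC_add_right scaleR_scaleC_commute norm_scaleC mult.commute)

lemma bounded_clinear_scaleR: "bounded_clinear A \<Longrightarrow> bounded_clinear (\<lambda>x. r *\<^sub>R A x)"
  by (simp add: bounded_clinear_def bounded_linear_const_scaleR scaleR_scaleC_commute)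

lemma bounded_clinear_op_word:
  "(\<And>i. bounded_clinear (X i)) \<Longrightarrow> bounded_clinear (op_word X \<alpha>)"
proof (induction \<alpha>)
  case Nil
  then show ?case by (simp add: bounded_clinear_id id_def)
next
  case (Cons i \<alpha>)
  then show ?case using bounded_clinear_compose[of "X i" "op_word X \<alpha>"] by (simp add: o_def)
qed

lemma bounded_linear_cinner_left: "bounded_linear (\<lambda>x. cinner x y)"
  for y :: "'a::complex_inner"
proof (rule bounded_linear_intro[where K = "norm y"])
  show "cinner (r *\<^sub>R x) y = r *\<^sub>R cinner x y" for r x
    by (metis cinner_scaleC_left scaleC_of_real scaleR_conv_of_real)
qed (auto simp: cinner_add_left cmod_cinner_le)

lemma bounded_linear_cinner_right: "bounded_linear (\<lambda>y. cinner x y)"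
  for x :: "'a::complex_inner"
proof (rule bounded_linear_intro[where K = "norm x"])
  show "cinner x (r *\<^sub>R y) = r *\<^sub>R cinner x y" for r y
    by (metis cinner_scaleC_right complex_cnj_complex_of_real scaleC_of_real scaleR_conv_of_real)
  show "cmod (cinner x y) \<le> norm y * norm x" for y
    using cmod_cinner_le[of x y] by (simp add: mult.commute)
qed (auto simp: cinner_add_right)

lemma cinner_eqI: "(\<And>x. cinner x y = cinner x z) \<Longrightarrow> y = z" for y z :: "'a::complex_inner"
proof -
  assume *: "\<And>x. cinner x y = cinner x z"
  have "cinner (y - z) (y - z) = cinner (y - z) y - cinner (y - z) z"
    by (rule linear_diff[OF bounded_linear.linear[OF bounded_linear_cinner_right]])
  then show ?thesis using * by (simp add: cinner_self)
qed

lemma cinner_eqI2: "(\<And>x. cinner y x = cinner z x) \<Longrightarrow> y = z" for y z :: "'a::complex_inner"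
  by (rule cinner_eqI) (metis cinner_commute)

section \<open>Adjoints\<close>

text \<open>The representing vector minimises \<open>\<parallel>x\<parallel>\<^sup>2 - 2 f x\<close>; by the parallelogram law every
  minimising sequence is Cauchy.\<close>

lemma riesz_real:
  fixes f :: "'a::{real_inner,complete_space} \<Rightarrow> real"
  assumes "bounded_linear f"
  obtains z where "\<And>x. f x = inner x z"
proof -
  interpret f: bounded_linear f by fact
  obtain K where K: "\<And>x. norm (f x) \<le> norm x * K" using f.bounded by blast
  define q where "q x = (norm x)\<^sup>2 - 2 * f x" for x
  have lower: "- K\<^sup>2 \<le> q x" for x
  proof -
    have "0 \<le> (norm x - K)\<^sup>2" by simp
    then have "- K\<^sup>2 \<le> (norm x)\<^sup>2 - 2 * (norm x * K)" by (simp add: power2_diff)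
    also have "\<dots> \<le> q x" unfolding q_def using K[of x] by auto
    finally show ?thesis .
  qed
  then have bdd: "bdd_below (range q)" by (auto simp: bdd_below_def)
  define m where "m = Inf (range q)"
  have m: "m \<le> q x" for x unfolding m_def by (simp add: cINF_lower[OF bdd])
  have "\<exists>x\<in>range q. x < m + inverse (real (Suc n))" for n
    by (rule cInf_lessD) (simp_all add: m_def)
  then have "\<exists>x. q x < m + inverse (real (Suc n))" for n by blast
  then obtain X where X: "\<And>n. q (X n) < m + inverse (real (Suc n))" by metis
  have par: "(norm (x - y))\<^sup>2 \<le> 2 * (q x - m) + 2 * (q y - m)" for x y
  proof -
    have "(norm (x - y))\<^sup>2 = 2 * q x + 2 * q y - 4 * q ((1/2) *\<^sub>R (x + y))"
    proof -
      have "(norm (x - y))\<^sup>2 = 2 * (norm x)\<^sup>2 + 2 * (norm y)\<^sup>2 - (norm (x + y))\<^sup>2"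
        by (simp add: power2_norm_eq_inner inner_add_left inner_add_right inner_diff_left
            inner_diff_right inner_commute)
      moreover have "(norm ((1/2) *\<^sub>R (x + y)))\<^sup>2 = (norm (x + y))\<^sup>2 / 4"
        by (simp add: power_divide del: scaleR_add_right)
      ultimately show ?thesis unfolding q_def f.scaleR f.add by (simp add: field_simps)
    qed
    then show ?thesis using m[of "(1/2) *\<^sub>R (x + y)"] by simp
  qed
  have "Cauchy X"
  proof (rule metric_CauchyI)
    fix e :: real assume e: "0 < e"
    then obtain N where N: "inverse (real (Suc N)) < e\<^sup>2 / 4"
      using reals_Archimedean[of "e\<^sup>2 / 4"] by auto
    have "dist (X k) (X l) < e" if "k \<ge> N" "l \<ge> N" for k l
    proof -
      have "inverse (real (Suc j)) \<le> inverse (real (Suc N))" if "j \<ge> N" for j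
        using that by (intro le_imp_inverse_le) auto
      then have *: "q (X j) - m < e\<^sup>2 / 4" if "j \<ge> N" for j
        using X[of j] N that by (smt (verit, best))
      have "(norm (X k - X l))\<^sup>2 < e\<^sup>2"
        using par[of "X k" "X l"] *[OF \<open>k \<ge> N\<close>] *[OF \<open>l \<ge> N\<close>] by simp
      then show ?thesis using e by (simp add: dist_norm power2_less_imp_less)
    qed
    then show "\<exists>M. \<forall>m\<ge>M. \<forall>n\<ge>M. dist (X m) (X n) < e" by blast
  qed
  then obtain z where z: "X \<longlonglongrightarrow> z" by (auto simp: Cauchy_convergent_iff convergent_def)
  have lim: "(\<lambda>n. q (X n)) \<longlonglongrightarrow> q z"
    unfolding q_def by (intro tendsto_intros z f.tendsto)
  have "(\<lambda>n. m + inverse (real (Suc n))) \<longlonglongrightarrow> m + 0"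
    by (intro tendsto_intros LIMSEQ_inverse_real_of_nat)
  from LIMSEQ_le[OF lim this] have qz: "q z \<le> m"
    using X by (auto intro: less_imp_le)
  have "f y = inner y z" for y
  proof (cases "y = 0")
    case False
    define d where "d = inner z y - f y"
    \<comment> \<open>\<open>t\<close> minimises the quadratic polynomial s \<mapsto> q (z + s y);
      since z already minimises q, the decrease \<open>d^2 / |y|^2\<close> must vanish.\<close>
    define t where "t = - d / (norm y)\<^sup>2"
    have "q (z + t *\<^sub>R y) = q z + 2 * t * d + t\<^sup>2 * (norm y)\<^sup>2"
    proof -
      have "(norm (z + t *\<^sub>R y))\<^sup>2 = (norm z)\<^sup>2 + 2 * t * inner z y + t\<^sup>2 * (norm y)\<^sup>2"
        unfolding power2_norm_eq_inner
        by (simp add: inner_add_left inner_add_right inner_commute power2_eq_square)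
      then show ?thesis unfolding q_def d_def f.scaleR f.add by (simp add: algebra_simps)
    qed
    moreover have "2 * t * d + t\<^sup>2 * (norm y)\<^sup>2 = - d\<^sup>2 / (norm y)\<^sup>2"
      using False by (simp add: t_def power2_eq_square field_simps)
    ultimately have "0 \<le> - d\<^sup>2 / (norm y)\<^sup>2"
      using m[of "z + t *\<^sub>R y"] qz by simp
    then have "d\<^sup>2 / (norm y)\<^sup>2 \<le> 0" by simp
    moreover have "0 < (norm y)\<^sup>2" using False by simp
    ultimately have "d\<^sup>2 \<le> 0" by (meson divide_pos_pos not_le)
    then have "d = 0" by simp
    then show ?thesis by (simp add: d_def inner_commute)
  qed (simp add: f.zero)
  then show ?thesis using that by blast
qed

lemma cadjoint_eqI:
  assumes "\<And>x y. cinner (A x) y = cinner x (B y)"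
  shows "cadjoint A = B"
  unfolding cadjoint_def
proof (rule the_equality)
  fix C assume C: "\<forall>x y. cinner (A x) y = cinner x (C y)"
  show "C = B" by (rule ext, rule cinner_eqI) (metis C assms)
qed (use assms in blast)

lemma cinner_cadjoint:
  fixes A :: "'a::chilbert_space \<Rightarrow> 'b::complex_inner"
  assumes A: "bounded_clinear A"
  shows "cinner (A x) y = cinner x (cadjoint A y)"
proof -
  interpret A: bounded_linear A using A by (simp add: bounded_clinear_def)
  have "\<exists>z. \<forall>x. cinner (A x) y = cinner x z" for y
  proof -
    have "bounded_linear (\<lambda>x. Re (cinner (A x) y))"
      by (intro bounded_linear_compose[OF bounded_linear_Re]
          bounded_linear_compose[OF bounded_linear_cinner_left] A.bounded_linear_axioms)
    from riesz_real[OF this] obtain z where z: "\<And>x. Re (cinner (A x) y) = inner x z" by blast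
    have re: "Re (cinner (A x) y) = Re (cinner x z)" for x
      using z by (simp add: inner_eq_Re_cinner)
    \<comment> \<open>The real Riesz theorem only controls real parts; replacing x by i x turns the
      real part into minus the imaginary part.\<close>
    have "Im (cinner (A x) y) = Im (cinner x z)" for x
      using re[of "\<i> *\<^sub>C x"] A by (simp add: bounded_clinear_def cinner_scaleC_left)
    then show ?thesis using re by (auto simp: complex_eq_iff)
  qed
  then obtain B where "\<And>x y. cinner (A x) y = cinner x (B y)" by metis
  then show ?thesis using cadjoint_eqI[of A B] by simp
qed

lemma bounded_clinear_cadjoint:
  fixes A :: "'a::chilbert_space \<Rightarrow> 'b::complex_inner"
  assumes A: "bounded_clinear A"
  shows "bounded_clinear (cadjoint A)"
proof -
  interpret A: bounded_linear A using A by (simp add: bounded_clinear_def)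
  note adj = cinner_cadjoint[OF A, symmetric]
  obtain K where K: "K > 0" "\<And>x. norm (A x) \<le> norm x * K" using A.pos_bounded by blast
  have bound: "norm (cadjoint A y) \<le> norm y * K" for y
  proof (cases "cadjoint A y = 0")
    case False
    have "complex_of_real ((norm (cadjoint A y))\<^sup>2) = cinner (A (cadjoint A y)) y"
      by (simp only: cinner_self[symmetric] adj)
    then have "(norm (cadjoint A y))\<^sup>2 = cmod (cinner (A (cadjoint A y)) y)"
      by (metis norm_of_real abs_power2)
    also have "\<dots> \<le> norm (cadjoint A y) * K * norm y"
      by (rule order_trans[OF cmod_cinner_le]) (simp add: K mult_right_mono)
    finally show ?thesis using False by (simp add: power2_eq_square mult_ac)
  qed (use K in simp)
  have add: "cadjoint A (x + y) = cadjoint A x + cadjoint A y" for x y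
    by (rule cinner_eqI) (simp add: adj cinner_add_right)
  have sc: "cadjoint A (c *\<^sub>C x) = c *\<^sub>C cadjoint A x" for c x
    by (rule cinner_eqI) (simp add: adj cinner_scaleC_right)
  have "cadjoint A (r *\<^sub>R x) = r *\<^sub>R cadjoint A x" for r x
    using sc[of "of_real r" x] by (simp add: scaleC_of_real)
  then show ?thesis
    unfolding bounded_clinear_def using add sc bound by (auto intro!: bounded_linear_intro)
qed

lemma cadjoint_op_word_Cons:
  fixes X :: "'n \<Rightarrow> 'a::chilbert_space \<Rightarrow> 'a"
  assumes X: "\<And>i. bounded_clinear (X i)"
  shows "cadjoint (op_word X (i # \<alpha>)) y = cadjoint (op_word X \<alpha>) (cadjoint (X i) y)"
proof -
  have "cadjoint (op_word X (i # \<alpha>)) = (\<lambda>y. cadjoint (op_word X \<alpha>) (cadjoint (X i) y))"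
    by (rule cadjoint_eqI)
       (simp add: cinner_cadjoint[OF X] cinner_cadjoint[OF bounded_clinear_op_word[OF X]])
  then show ?thesis by simp
qed

lemma cadjoint_op_word_Nil: "cadjoint (op_word X []) y = y"
proof -
  have "cadjoint (op_word X []) = (\<lambda>y. y)" by (rule cadjoint_eqI) simp
  then show ?thesis by simp
qed

section \<open>Square roots of positive operators\<close>

text \<open>The Taylor coefficients of \<open>(1 - x)\<^sup>1\<^sup>/\<^sup>2\<close>. Applied to the contraction \<open>B = I - A/c\<close>, the series
  gives a square root of \<open>A/c\<close>.\<close>

definition sqrt_coeff :: "nat \<Rightarrow> real" where
  "sqrt_coeff k = (-1) ^ k * ((1/2) gchoose k)"

lemma sqrt_coeff_Suc: "sqrt_coeff (Suc k) = sqrt_coeff k * (real k - 1/2) / (real k + 1)"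
proof -
  have gb: "- ((1/2 :: real) gchoose Suc k) = ((1/2) gchoose k) * ((real k - 1/2) / (real k + 1))"
    using gbinomial_mult_1[of "1/2 :: real" k] by (simp add: field_simps)
  have "sqrt_coeff (Suc k) = (-1) ^ k * - ((1/2) gchoose Suc k)" by (simp add: sqrt_coeff_def)
  then show ?thesis unfolding gb sqrt_coeff_def by simp
qed

lemma sqrt_coeff_nonpos: "sqrt_coeff (Suc k) \<le> 0"
proof (induction k)
  case 0
  show ?case by (simp add: sqrt_coeff_def)
next
  case (Suc k)
  then show ?case
    using sqrt_coeff_Suc[of "Suc k"] by (simp add: divide_le_0_iff mult_le_0_iff)
qed

text \<open>The partial sums are the coefficients of (1 - x)^(-1/2). Together with
  \<open>sqrt_coeff_nonpos\<close> the closed form makes them nonnegative, which yields absolute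
  summability.\<close>

lemma sum_sqrt_coeff: "(\<Sum>k\<le>N. sqrt_coeff k) = - 2 * (real N + 1) * sqrt_coeff (Suc N)"
proof (induction N)
  case 0
  show ?case by (simp add: sqrt_coeff_def)
next
  case (Suc N)
  then show ?case using sqrt_coeff_Suc[of "Suc N"] by (simp add: field_simps)
qed

lemma summable_sqrt_coeff: "summable (\<lambda>k. \<bar>sqrt_coeff k\<bar>)"
proof (rule summableI_nonneg_bounded)
  fix N
  \<comment> \<open>Only the coefficient at 0 is positive, and it equals 1; taking absolute values
    flips the sign of all the others.\<close>
  have eq: "(\<Sum>k\<le>N. \<bar>sqrt_coeff k\<bar>) = 2 - (\<Sum>k\<le>N. sqrt_coeff k)" for N
    by (induction N) (use sqrt_coeff_nonpos in \<open>simp_all add: sqrt_coeff_def[of 0]\<close>)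
  have "0 \<le> (\<Sum>k\<le>N. sqrt_coeff k)" for N
    unfolding sum_sqrt_coeff by (rule mult_nonpos_nonpos) (simp_all add: sqrt_coeff_nonpos)
  then have "(\<Sum>k\<le>N. \<bar>sqrt_coeff k\<bar>) \<le> 2"
    by (simp add: eq)
  moreover have "(\<Sum>k<N. \<bar>sqrt_coeff k\<bar>) \<le> (\<Sum>k\<le>N. \<bar>sqrt_coeff k\<bar>)"
    by (rule sum_mono2) auto
  ultimately show "(\<Sum>k<N. \<bar>sqrt_coeff k\<bar>) \<le> 2" by simp
qed simp

text \<open>The square of (1 - x)^(1/2) is 1 - x: Vandermonde turns the convolution into binomial
  coefficients of 1/2 + 1/2 = 1.\<close>

lemma sqrt_coeff_convolution:
  "(\<Sum>i\<le>k. sqrt_coeff i * sqrt_coeff (k - i)) = (if k = 0 then 1 else if k = 1 then -1 else 0)"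
proof -
  have "(\<Sum>i\<le>k. sqrt_coeff i * sqrt_coeff (k - i))
      = (\<Sum>i\<le>k. (-1) ^ k * (((1/2) gchoose i) * ((1/2) gchoose (k - i))))"
    unfolding sqrt_coeff_def
    by (rule sum.cong) (auto simp: power_add[symmetric] mult_ac)
  also have "\<dots> = (-1) ^ k * ((1/2 + 1/2 :: real) gchoose k)"
    unfolding sum_distrib_left[symmetric] gbinomial_Vandermonde[symmetric] atLeast0AtMost ..
  also have "(1/2 + 1/2 :: real) gchoose k = of_nat (1 choose k)"
    using binomial_gbinomial[of 1 k, where 'a = real] by simp
  finally show ?thesis by (cases k) (auto simp: binomial_eq_0)
qed

text \<open>Polarization: the form x \<mapsto> <A x, x> is real, and evaluating it at x + y and x +
  i y gives the imaginary and the real part.\<close>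

lemma nonneg_op_symmetric:
  assumes A: "bounded_clinear A" and "nonneg_op A"
  shows "cinner (A x) y = cinner x (A y)"
proof -
  have lin: "A (x + y) = A x + A y" "A (c *\<^sub>C x) = c *\<^sub>C A x" for x y c
    using A linear_add[OF bounded_clinear_imp_linear[OF A]] by (auto simp: bounded_clinear_def)
  have im: "Im (cinner (A x) x) = 0" for x
    using \<open>nonneg_op A\<close> by (auto simp: nonneg_op_def complex_nonneg_Reals_iff)
  have 1: "Im (cinner (A x) y) + Im (cinner (A y) x) = 0" for x y
    using im[of "x + y"] im[of x] im[of y]
    by (simp add: lin cinner_add_left cinner_add_right)
  have 2: "Re (cinner (A x) y) = Re (cinner (A y) x)"
    using 1[of x "\<i> *\<^sub>C y"] by (simp add: lin cinner_scaleC_left cinner_scaleC_right)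
  show ?thesis
    using 1[of x y] 2 cinner_commute[of x "A y"] by (simp add: complex_eq_iff)
qed

text \<open>After expanding the square, the claim follows from (1/c) |A x|^2 \<le> <A x, x>.\<close>

lemma nonneg_op_contraction:
  assumes A: "bounded_clinear A" "nonneg_op A" and c: "c > 0" "\<And>x. norm (A x) \<le> c * norm x"
  shows "norm (x - (1/c) *\<^sub>R A x) \<le> norm x"
proof -
  interpret A: bounded_linear A using A by (simp add: bounded_clinear_def)
  have sym: "inner (A x) y = inner x (A y)" for x y
    by (simp add: inner_eq_Re_cinner nonneg_op_symmetric[OF A])
  have pos: "0 \<le> inner (A x) x" for x
    using A(2) by (simp add: nonneg_op_def inner_eq_Re_cinner complex_nonneg_Reals_iff)
  have "inner (A (A x)) (A x) \<le> c * (norm (A x))\<^sup>2"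
  proof -
    have "inner (A (A x)) (A x) \<le> norm (A (A x)) * norm (A x)" by (rule norm_cauchy_schwarz)
    also have "\<dots> \<le> c * norm (A x) * norm (A x)" by (rule mult_right_mono[OF c(2)]) simp
    finally show ?thesis by (simp add: power2_eq_square)
  qed
  then have "(1/c)\<^sup>2 * inner (A (A x)) (A x) \<le> (1/c)\<^sup>2 * (c * (norm (A x))\<^sup>2)"
    by (rule mult_left_mono) simp
  also have "\<dots> = (1/c) * (norm (A x))\<^sup>2" using c(1) by (simp add: power2_eq_square)
  finally have le: "(1/c)\<^sup>2 * inner (A (A x)) (A x) \<le> (1/c) * (norm (A x))\<^sup>2" .
  \<comment> \<open>Positivity tested at x - A x / c, with the cubic term bounded by
    \<open>le\<close>, gives the inequality (1/c) |A x|^2 \<le> <A x, x>.\<close>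
  have "0 \<le> inner (A (x - (1/c) *\<^sub>R A x)) (x - (1/c) *\<^sub>R A x)" by (rule pos)
  also have "\<dots> = inner (A x) x - 2 * (1/c) * (norm (A x))\<^sup>2 + (1/c)\<^sup>2 * inner (A (A x)) (A x)"
    unfolding A.diff A.scaleR
    using sym[of "A x" x] c(1)
    by (simp add: inner_diff_left inner_diff_right power2_norm_eq_inner[symmetric])
       (simp add: field_simps power2_eq_square)
  also have "\<dots> \<le> inner (A x) x - (1/c) * (norm (A x))\<^sup>2" using le by simp
  finally have "(1/c) * (norm (A x))\<^sup>2 \<le> inner (A x) x" by simp
  then have "(1/c) * ((1/c) * (norm (A x))\<^sup>2) \<le> (1/c) * inner (A x) x"
    by (rule mult_left_mono) (use c in simp)
  moreover have "0 \<le> (1/c) * inner (A x) x" using pos[of x] c by simp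
  moreover have "(norm (x - (1/c) *\<^sub>R A x))\<^sup>2
      = (norm x)\<^sup>2 - 2 * ((1/c) * inner (A x) x) + (1/c) * ((1/c) * (norm (A x))\<^sup>2)"
    by (simp add: power2_norm_eq_inner inner_diff_left inner_diff_right inner_commute)
  ultimately have "(norm (x - (1/c) *\<^sub>R A x))\<^sup>2 \<le> (norm x)\<^sup>2" by linarith
  then show ?thesis by (simp add: power2_le_iff_abs_le)
qed

text \<open>R is \<surd>c times the power series of (1 - x)^(1/2) evaluated at B = I - A/c. Only the
  norm identity is recorded: it is what makes the dilation built from R isometric.\<close>

lemma nonneg_op_root:
  fixes A :: "'a::chilbert_space \<Rightarrow> 'a"
  assumes A: "bounded_clinear A" "nonneg_op A"
  obtains R :: "'a \<Rightarrow> 'a"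
    where "bounded_clinear R" "\<And>x. (norm (R x))\<^sup>2 = Re (cinner (A x) x)"
proof -
  interpret A: bounded_linear A using A by (simp add: bounded_clinear_def)
  obtain c where c: "c > 0" "\<And>x. norm (A x) \<le> norm x * c" using A.pos_bounded by blast
  define B where "B x = x - (1/c) *\<^sub>R A x" for x
  have B_norm: "norm (B x) \<le> norm x" for x
    unfolding B_def by (rule nonneg_op_contraction[OF A c(1)]) (use c(2) in \<open>simp add: mult.commute\<close>)
  define P where "P k = B ^^ k" for k
  have P_Suc: "P (Suc k) x = B (P k x)" for k x by (simp add: P_def)
  have P_norm: "norm (P k x) \<le> norm x" for k x
    by (induction k) (auto simp: P_def intro: order_trans[OF B_norm])
  have P_lin: "P k (x + y) = P k x + P k y" "P k (d *\<^sub>C x) = d *\<^sub>C P k x" for k x y d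
    using A(1)
    by (induction k) (auto simp: P_def B_def A.add bounded_clinear_def algebra_simps
        complex_vector.scale_right_diff_distrib scaleR_scaleC_commute)
  have B_sym: "inner (B x) y = inner x (B y)" for x y
    unfolding B_def
    by (simp add: inner_diff_left inner_diff_right inner_eq_Re_cinner[of "A x" y]
        inner_eq_Re_cinner[of x "A y"] nonneg_op_symmetric[OF A])
  \<comment> \<open>Symmetry of B makes these inner products depend on i + j alone, so the double
    series for |R x|^2 can be grouped along diagonals.\<close>
  have P_inner: "inner (P i x) (P j x) = inner (P (i + j) x) x" for i j x
  proof (induction j arbitrary: i)
    case (Suc j)
    have "inner (P i x) (P (Suc j) x) = inner (P (Suc i) x) (P j x)"
      by (simp add: P_Suc B_sym)
    then show ?case by (simp add: Suc)
  qed (simp add: P_def)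
  define R where "R x = (\<Sum>k. sqrt_coeff k *\<^sub>R P k x)" for x
  have term_le: "norm (sqrt_coeff k *\<^sub>R P k x) \<le> \<bar>sqrt_coeff k\<bar> * norm x" for k x
    by (simp add: mult_left_mono P_norm)
  have abs_summ: "summable (\<lambda>k. norm (sqrt_coeff k *\<^sub>R P k x))" for x
    using term_le
    by (intro summable_comparison_test'[OF summable_mult2[OF summable_sqrt_coeff], of 0 _ "norm x"]) auto
  note summ = summable_norm_cancel[OF abs_summ]
  have R_bound: "norm (R x) \<le> norm x * (\<Sum>k. \<bar>sqrt_coeff k\<bar>)" for x
  proof -
    have "norm (R x) \<le> (\<Sum>k. norm (sqrt_coeff k *\<^sub>R P k x))"
      unfolding R_def by (rule summable_norm[OF abs_summ])
    also have "\<dots> \<le> (\<Sum>k. \<bar>sqrt_coeff k\<bar> * norm x)"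
      by (intro suminf_le term_le abs_summ summable_mult2 summable_sqrt_coeff)
    also have "\<dots> = norm x * (\<Sum>k. \<bar>sqrt_coeff k\<bar>)"
      using suminf_mult2[OF summable_sqrt_coeff, of "norm x"] by (simp add: mult.commute)
    finally show ?thesis .
  qed
  have R_add: "R (x + y) = R x + R y" for x y
    unfolding R_def P_lin scaleR_add_right by (rule suminf_add[symmetric]) (rule summ)+
  have R_scaleC: "R (d *\<^sub>C x) = d *\<^sub>C R x" for d x
  proof -
    from bounded_linear.suminf[OF bounded_linear_scaleC summ] show ?thesis
      unfolding R_def P_lin scaleR_scaleC_commute by simp
  qed
  have "R (r *\<^sub>R x) = r *\<^sub>R R x" for r x
    using R_scaleC[of "of_real r" x] by (simp add: scaleC_of_real)
  then have R: "bounded_clinear R"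
    unfolding bounded_clinear_def using R_add R_scaleC R_bound by (auto intro!: bounded_linear_intro)
  have R_sq: "(norm (R x))\<^sup>2 = (1/c) * Re (cinner (A x) x)" for x
  proof -
    define u where "u k = inner (P k x) x" for k
    \<comment> \<open>The terms of the double series for |R x|^2. They are dominated by |x|^2 times
      a product of two summable sequences, so regrouping is legitimate.\<close>
    define f where "f = (\<lambda>(i, j). sqrt_coeff i * sqrt_coeff j * u (i + j))"
    have u_le: "\<bar>u k\<bar> \<le> (norm x)\<^sup>2" for k
      using Cauchy_Schwarz_ineq2[of "P k x" x] mult_right_mono[OF P_norm[of k x], of "norm x"]
      by (simp add: u_def power2_eq_square)
    have f_summ: "f summable_on UNIV \<times> UNIV"
    proof (rule abs_summable_summable, rule summable_on_comparison_test)
      have "(\<lambda>k. \<bar>sqrt_coeff k\<bar>) summable_on UNIV"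
        using norm_summable_imp_summable_on[of sqrt_coeff] summable_sqrt_coeff
        by (intro norm_summable_imp_summable_on) simp
      then have "(\<lambda>(i, j). \<bar>sqrt_coeff i\<bar> * \<bar>sqrt_coeff j\<bar>) summable_on UNIV \<times> UNIV"
        by (intro summable_on_SigmaI[where g = "\<lambda>i. \<bar>sqrt_coeff i\<bar> * (\<Sum>\<^sub>\<infinity>j. \<bar>sqrt_coeff j\<bar>)"])
           (auto intro!: has_sum_cmult_right summable_on_cmult_left)
      then show "(\<lambda>p. (norm x)\<^sup>2 * (case p of (i, j) \<Rightarrow> \<bar>sqrt_coeff i\<bar> * \<bar>sqrt_coeff j\<bar>)) summable_on UNIV \<times> UNIV"
        by (rule summable_on_cmult_right)
      show "norm (f p) \<le> (norm x)\<^sup>2 * (case p of (i, j) \<Rightarrow> \<bar>sqrt_coeff i\<bar> * \<bar>sqrt_coeff j\<bar>)" for p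
        using mult_left_mono[OF u_le, of "\<bar>sqrt_coeff i\<bar> * \<bar>sqrt_coeff j\<bar>" "i + j" for i j]
        by (auto simp: f_def abs_mult mult_ac split: prod.split)
    qed auto
    have R_sum: "((\<lambda>k. sqrt_coeff k *\<^sub>R P k x) has_sum R x) UNIV"
      unfolding R_def by (rule norm_summable_imp_has_sum[OF abs_summ summable_sums[OF summ]])
    have inner_f: "inner (sqrt_coeff i *\<^sub>R P i x) (sqrt_coeff j *\<^sub>R P j x) = f (i, j)" for i j
      by (simp add: f_def u_def P_inner)
    have "((\<lambda>j. f (i, j)) has_sum inner (sqrt_coeff i *\<^sub>R P i x) (R x)) UNIV" for i
      unfolding inner_f[symmetric] by (rule has_sum_bounded_linear[OF bounded_linear_inner_right R_sum])
    moreover have "((\<lambda>i. inner (sqrt_coeff i *\<^sub>R P i x) (R x)) has_sum inner (R x) (R x)) UNIV"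
      by (rule has_sum_bounded_linear[OF bounded_linear_inner_left R_sum])
    ultimately have 1: "(f has_sum inner (R x) (R x)) (UNIV \<times> UNIV)"
      using f_summ by (intro has_sum_SigmaI) auto
    \<comment> \<open>Regrouping along k = i + j: the pair (k, i) stands for (i, k - i), and i \<le>
      k keeps the natural subtraction exact.\<close>
    have 2: "((\<lambda>(k, i). sqrt_coeff i * sqrt_coeff (k - i) * u k) has_sum inner (R x) (R x))
        (SIGMA k : UNIV. {..k})"
      by (rule has_sum_reindex_bij_witness[where j = "\<lambda>(k, i). (i, k - i)" and i = "\<lambda>(i, j). (i + j, i)",
            THEN iffD2, OF _ _ _ _ _ _ 1]) (auto simp: f_def)
    have "((\<lambda>k. (\<Sum>i\<le>k. sqrt_coeff i * sqrt_coeff (k - i)) * u k) has_sum inner (R x) (R x)) UNIV"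
      unfolding sum_distrib_right by (rule has_sum_SigmaD[OF 2]) (simp add: has_sum_finite)
    moreover have "((\<lambda>k. (\<Sum>i\<le>k. sqrt_coeff i * sqrt_coeff (k - i)) * u k) has_sum
        (\<Sum>k\<in>{0,1}. (\<Sum>i\<le>k. sqrt_coeff i * sqrt_coeff (k - i)) * u k)) UNIV"
      by (rule has_sum_finite_neutralI[where B = "{0,1}"]) (auto simp: sqrt_coeff_convolution)
    ultimately have "inner (R x) (R x) = (\<Sum>k\<in>{0,1}. (\<Sum>i\<le>k. sqrt_coeff i * sqrt_coeff (k - i)) * u k)"
      by (rule has_sum_unique)
    \<comment> \<open>The convolution leaves <x - B x, x>, which is <A x, x> / c.\<close>
    also have "\<dots> = u 0 - u 1" unfolding sqrt_coeff_convolution by simp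
    also have "\<dots> = (1/c) * Re (cinner (A x) x)"
      by (simp add: u_def P_def B_def inner_diff_left inner_eq_Re_cinner[of "A x" x])
    finally show ?thesis by (simp add: power2_norm_eq_inner)
  qed
  show ?thesis
  proof (rule that)
    show "bounded_clinear (\<lambda>x. sqrt c *\<^sub>R R x)" by (rule bounded_clinear_scaleR[OF R])
    show "(norm (sqrt c *\<^sub>R R x))\<^sup>2 = Re (cinner (A x) x)" for x
      using c(1) by (simp add: power_mult_distrib R_sq)
  qed
qed

section \<open>Operators between spaces of square-summable families\<close>

lemma l2_coord_sum: "l2_coord (\<Sum>a\<in>A. F a) i = (\<Sum>a\<in>A. l2_coord (F a) i)"
  by (induction A rule: infinite_finite_induct) auto

text \<open>A weighted composition operator; one construction yields both the weighted shifts and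
  their adjoints. \<open>Abs_l2\<close> is meaningful only for square-summable families, which
  injectivity of p on D and bounded weights guarantee.\<close>

definition l2_wcomp ::
  "('j \<Rightarrow> real) \<Rightarrow> 'j set \<Rightarrow> ('j \<Rightarrow> 'i) \<Rightarrow> ('i, 'a::complex_inner) l2 \<Rightarrow> ('j, 'a) l2" where
  "l2_wcomp c D p f = Abs_l2 (\<lambda>j. if j \<in> D then c j *\<^sub>R l2_coord f (p j) else 0)"

context
  fixes c :: "'j \<Rightarrow> real" and D :: "'j set" and p :: "'j \<Rightarrow> 'i" and C :: real
  assumes inj: "inj_on p D" and C: "\<And>j. j \<in> D \<Longrightarrow> \<bar>c j\<bar> \<le> C"
begin

text \<open>Injectivity of p on D means that each coordinate of f is used at most once, so the
  square sum grows by at most the factor \<open>C^2\<close>.\<close>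

lemma l2_wcomp_aux:
  fixes f :: "('i, 'a::complex_inner) l2"
  defines "h \<equiv> \<lambda>j. (norm (if j \<in> D then c j *\<^sub>R l2_coord f (p j) else 0))\<^sup>2"
  shows "h summable_on UNIV" "infsum h UNIV \<le> C\<^sup>2 * (norm f)\<^sup>2"
proof -
  have im: "(\<lambda>i. (norm (l2_coord f i))\<^sup>2) summable_on p ` D"
    by (rule summable_on_subset_banach[OF l2_summable]) simp
  then have pD: "(\<lambda>j. (norm (l2_coord f (p j)))\<^sup>2) summable_on D"
    using summable_on_reindex[OF inj] by (metis (no_types, lifting) comp_apply summable_on_cong)
  have le: "h j \<le> C\<^sup>2 * (norm (l2_coord f (p j)))\<^sup>2" if "j \<in> D" for j
  proof -
    have "(c j)\<^sup>2 \<le> C\<^sup>2"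
      using power_mono[OF C[OF that], of 2] by simp
    then show ?thesis
      using that by (simp add: h_def power_mult_distrib mult_right_mono)
  qed
  have hD: "h summable_on D"
    by (rule summable_on_comparison_test[OF summable_on_cmult_right[OF pD] le]) (auto simp: h_def)
  then show "h summable_on UNIV"
    by (rule summable_on_cong_neutral[THEN iffD1, rotated 3]) (auto simp: h_def)
  have "infsum h UNIV = infsum h D"
    by (rule infsum_cong_neutral) (auto simp: h_def)
  also have "\<dots> \<le> (\<Sum>\<^sub>\<infinity>j\<in>D. C\<^sup>2 * (norm (l2_coord f (p j)))\<^sup>2)"
    by (rule infsum_mono[OF hD summable_on_cmult_right[OF pD] le])
  also have "\<dots> = C\<^sup>2 * (\<Sum>\<^sub>\<infinity>j\<in>D. (norm (l2_coord f (p j)))\<^sup>2)"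
    by (rule infsum_cmult_right')
  also have "(\<Sum>\<^sub>\<infinity>j\<in>D. (norm (l2_coord f (p j)))\<^sup>2) = (\<Sum>\<^sub>\<infinity>i\<in>p ` D. (norm (l2_coord f i))\<^sup>2)"
    by (subst infsum_reindex[OF inj]) (simp add: o_def)
  also have "\<dots> \<le> (norm f)\<^sup>2"
    unfolding l2_norm_sq by (rule infsum_mono_neutral[OF im l2_summable]) auto
  finally show "infsum h UNIV \<le> C\<^sup>2 * (norm f)\<^sup>2" by (simp add: mult_left_mono)
qed

lemma l2_coord_wcomp:
  fixes f :: "('i, 'a::complex_inner) l2"
  shows "l2_coord (l2_wcomp c D p f) j = (if j \<in> D then c j *\<^sub>R l2_coord f (p j) else 0)"
  unfolding l2_wcomp_def using l2_wcomp_aux(1)[of f] by (subst Abs_l2_inverse) auto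

lemma bounded_clinear_wcomp:
  "bounded_clinear (l2_wcomp c D p :: ('i, 'a::complex_inner) l2 \<Rightarrow> ('j, 'a) l2)"
proof -
  have "norm (l2_wcomp c D p f) \<le> norm f * \<bar>C\<bar>" for f :: "('i, 'a) l2"
  proof -
    have "(norm (l2_wcomp c D p f))\<^sup>2 \<le> (norm f * \<bar>C\<bar>)\<^sup>2"
      using l2_wcomp_aux(2)[of f]
      by (simp add: l2_norm_sq[of "l2_wcomp c D p f"] l2_coord_wcomp power_mult_distrib mult.commute)
    then show ?thesis by (simp add: power2_le_iff_abs_le)
  qed
  then show ?thesis
    unfolding bounded_clinear_def
    by (auto intro!: bounded_linear_intro[where K = "\<bar>C\<bar>"] l2_eqI
        simp: l2_coord_wcomp scaleR_add_right scaleR_scaleC_commute)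
qed

lemma l2_wcomp_tensor:
  "l2_wcomp c D p (\<phi> \<otimes>\<^sub>2 x) = l2_wcomp c D p \<phi> \<otimes>\<^sub>2 (x :: 'a::complex_inner)"
  by (rule l2_eqI)
     (simp add: l2_coord_wcomp scaleC_of_real[symmetric] scaleC_scaleC scaleR_conv_of_real
       scaleC_complex_def)

end

text \<open>Such an operator only relocates coordinates and scales them by reals, so its ampliation
  is given by the same formula on vector-valued families.\<close>

lemma ampliation_wcomp:
  assumes "inj_on p D" "\<And>j. j \<in> D \<Longrightarrow> \<bar>c j\<bar> \<le> C"
  shows "ampliation (l2_wcomp c D p) = (l2_wcomp c D p :: ('i, 'a::complex_inner) l2 \<Rightarrow> ('i, 'a) l2)"
  by (rule ampliation_eqI)
     (auto intro: bounded_clinear_wcomp[OF assms] simp: l2_wcomp_tensor[OF assms])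

text \<open>Dominated convergence for diagonal operators: a finite set carries f up to \<delta>, the
  multipliers are eventually exact on it, and off it they differ by at most 2M. It serves both for
  truncated defects and for truncating a vector to short words.\<close>

lemma l2_multiplier_tendsto:
  fixes f G :: "('i, 'a::complex_inner) l2" and F :: "nat \<Rightarrow> ('i, 'a) l2"
  assumes F: "\<And>k i. l2_coord (F k) i = c k i *\<^sub>R l2_coord f i"
    and G: "\<And>i. l2_coord G i = c\<^sub>0 i *\<^sub>R l2_coord f i"
    and bound: "\<And>k i. \<bar>c k i\<bar> \<le> M"
    and ev: "\<And>i. \<forall>\<^sub>F k in sequentially. c k i = c\<^sub>0 i"
  shows "F \<longlonglongrightarrow> G"
proof (rule metric_LIMSEQ_I)
  fix e :: real assume e: "0 < e"
  have c0: "\<bar>c\<^sub>0 i\<bar> \<le> M" for i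
    using eventually_happens'[OF sequentially_bot ev[of i]] bound by metis
  have M: "0 \<le> M" using bound by (meson abs_ge_zero order_trans)
  \<comment> \<open>The tail contributes at most 4 M^2 \<delta>, which is below e^2; the added 1
    also covers M = 0.\<close>
  define \<delta> where "\<delta> = e\<^sup>2 / (4 * M\<^sup>2 + 1)"
  have \<delta>: "\<delta> > 0" using e by (simp add: \<delta>_def add_nonneg_pos)
  have "((\<lambda>i. (norm (l2_coord f i))\<^sup>2) has_sum (norm f)\<^sup>2) UNIV"
    unfolding l2_norm_sq by (rule has_sum_infsum[OF l2_summable])
  then obtain A where A: "finite A" "dist (\<Sum>i\<in>A. (norm (l2_coord f i))\<^sup>2) ((norm f)\<^sup>2) < \<delta>"
    using \<delta> unfolding has_sum_def tendsto_iff eventually_finite_subsets_at_top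
    by (metis order_refl subset_UNIV)
  have tail: "(\<Sum>\<^sub>\<infinity>i\<in>UNIV - A. (norm (l2_coord f i))\<^sup>2) < \<delta>"
  proof -
    have "(\<Sum>\<^sub>\<infinity>i\<in>UNIV - A. (norm (l2_coord f i))\<^sup>2) = (norm f)\<^sup>2 - (\<Sum>i\<in>A. (norm (l2_coord f i))\<^sup>2)"
      unfolding l2_norm_sq
      by (subst infsum_Diff) (auto simp: l2_summable A(1) intro: summable_on_finite)
    then show ?thesis using A(2) by (simp add: dist_real_def)
  qed
  have "\<forall>\<^sub>F k in sequentially. \<forall>i\<in>A. c k i = c\<^sub>0 i"
    using A(1) ev by (simp add: eventually_ball_finite)
  then obtain N where N: "\<And>k i. k \<ge> N \<Longrightarrow> i \<in> A \<Longrightarrow> c k i = c\<^sub>0 i"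
    by (auto simp: eventually_sequentially)
  have "dist (F k) G < e" if k: "k \<ge> N" for k
  proof -
    have coord: "l2_coord (F k - G) i = (c k i - c\<^sub>0 i) *\<^sub>R l2_coord f i" for i
      by (simp add: F G scaleR_diff_left)
    have le: "(norm (l2_coord (F k - G) i))\<^sup>2 \<le> 4 * M\<^sup>2 * (norm (l2_coord f i))\<^sup>2" for i
    proof -
      have "\<bar>c k i - c\<^sub>0 i\<bar> \<le> 2 * M"
        using bound[of k i] c0[of i] by linarith
      from power_mono[OF this, of 2] have "(c k i - c\<^sub>0 i)\<^sup>2 \<le> 4 * M\<^sup>2"
        by (simp add: power_mult_distrib)
      then show ?thesis
        unfolding coord by (simp add: power_mult_distrib mult_right_mono)
    qed
    have S: "(\<lambda>i. (norm (l2_coord f i))\<^sup>2) summable_on UNIV - A"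
      "(\<lambda>i. (norm (l2_coord (F k - G) i))\<^sup>2) summable_on UNIV - A"
      by (rule summable_on_subset_banach[OF l2_summable], simp)+
    have "(norm (F k - G))\<^sup>2 = (\<Sum>\<^sub>\<infinity>i\<in>UNIV - A. (norm (l2_coord (F k - G) i))\<^sup>2)"
      unfolding l2_norm_sq by (rule infsum_cong_neutral) (auto simp: F G N[OF k])
    also have "\<dots> \<le> (\<Sum>\<^sub>\<infinity>i\<in>UNIV - A. 4 * M\<^sup>2 * (norm (l2_coord f i))\<^sup>2)"
      by (rule infsum_mono[OF S(2) summable_on_cmult_right[OF S(1)] le])
    also have "\<dots> = 4 * M\<^sup>2 * (\<Sum>\<^sub>\<infinity>i\<in>UNIV - A. (norm (l2_coord f i))\<^sup>2)"
      by (rule infsum_cmult_right')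
    also have "\<dots> \<le> 4 * M\<^sup>2 * \<delta>"
      using tail by (intro mult_left_mono) auto
    also have "\<dots> < (4 * M\<^sup>2 + 1) * \<delta>" using \<delta> by (simp add: algebra_simps)
    also have "\<dots> = e\<^sup>2"
      by (simp add: \<delta>_def add_nonneg_pos less_imp_neq[symmetric] add_nonneg_eq_0_iff)
    finally show ?thesis using e by (simp add: dist_norm power2_less_imp_less)
  qed
  then show "\<exists>N. \<forall>k\<ge>N. dist (F k) G < e" by blast
qed

section \<open>Weighted shifts by words\<close>

text \<open>This is W_\<alpha> \<otimes> I: the one-letter weights along \<alpha> telescope to a
  single quotient. The polymorphic value type covers scalar Fock space and its ampliations at
  once.\<close>

definition word_shift :: "('n list \<Rightarrow> real) \<Rightarrow> 'n list \<Rightarrow> ('n list, 'a::complex_inner) l2 \<Rightarrow> ('n list, 'a) l2"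
  where "word_shift b \<alpha> =
    l2_wcomp (\<lambda>\<beta>. sqrt (b (drop (length \<alpha>) \<beta>) / b \<beta>)) (range ((@) \<alpha>)) (drop (length \<alpha>))"

definition word_backshift :: "('n list \<Rightarrow> real) \<Rightarrow> 'n list \<Rightarrow> ('n list, 'a::complex_inner) l2 \<Rightarrow> ('n list, 'a) l2"
  where "word_backshift b \<alpha> = l2_wcomp (\<lambda>\<gamma>. sqrt (b \<gamma> / b (\<alpha> @ \<gamma>))) UNIV ((@) \<alpha>)"

definition vacuum_proj :: "('n list, 'a::complex_inner) l2 \<Rightarrow> ('n list, 'a) l2" where
  "vacuum_proj f = l2_unit [] \<otimes>\<^sub>2 l2_coord f []"

text \<open>The partial sum, through degree k, of the defect series of the universal model, tensored
  with the identity.\<close>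

definition partial_defect ::
  "('n::finite list \<Rightarrow> real) \<Rightarrow> nat \<Rightarrow> ('n list, 'a::complex_inner) l2 \<Rightarrow> ('n list, 'a) l2" where
  "partial_defect b k f =
    (\<Sum>p\<le>k. \<Sum>\<alpha> | length \<alpha> = p. nc_inverse b \<alpha> *\<^sub>R word_shift b \<alpha> (word_backshift b \<alpha> f))"

text \<open>The diagonal entry of \<open>partial_defect\<close> at e_\<beta>; it does not depend on
  the value space.\<close>

definition defect_coeff :: "('n::finite list \<Rightarrow> real) \<Rightarrow> nat \<Rightarrow> 'n list \<Rightarrow> real" where
  "defect_coeff b k \<beta> = (\<Sum>p\<le>k. \<Sum>\<alpha> | length \<alpha> = p.
     if \<beta> \<in> range ((@) \<alpha>) then nc_inverse b \<alpha> * (b (drop (length \<alpha>) \<beta>) / b \<beta>) else 0)"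

lemma finite_words: "finite {\<alpha> :: 'n::finite list. length \<alpha> = k}"
  using finite_lists_length_eq[of "UNIV :: 'n set" k] by simp

section \<open>The universal model as weighted word shifts, and its truncated defects\<close>

locale admissible_series =
  fixes b :: "'n::finite list \<Rightarrow> real"
  assumes adm: "admissible b"
begin

lemma b_Nil: "b [] = 1" and b_pos: "0 < b \<alpha>"
  using adm by (auto simp: admissible_def)

text \<open>The quotient factors letter by letter along \<alpha>, and admissibility bounds each
  factor. The bound may depend on \<alpha>.\<close>

lemma weight_bound:
  obtains C where "\<And>\<gamma>. sqrt (b \<gamma> / b (\<alpha> @ \<gamma>)) \<le> C"
proof -
  have "\<exists>C. \<forall>\<gamma>. b \<gamma> / b (\<alpha> @ \<gamma>) \<le> C"
  proof (induction \<alpha>)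
    case Nil
    show ?case using b_pos by (auto intro!: exI[of _ 1] simp: less_imp_neq[symmetric])
  next
    case (Cons i \<alpha>)
    then obtain C where C: "\<And>\<gamma>. b \<gamma> / b (\<alpha> @ \<gamma>) \<le> C" by blast
    obtain K where K: "\<And>\<gamma>. b \<gamma> / b (i # \<gamma>) \<le> K"
      using adm unfolding admissible_def bdd_above_def by blast
    have "b \<gamma> / b ((i # \<alpha>) @ \<gamma>) \<le> C * K" for \<gamma>
    proof -
      have "b \<gamma> / b ((i # \<alpha>) @ \<gamma>) = (b \<gamma> / b (\<alpha> @ \<gamma>)) * (b (\<alpha> @ \<gamma>) / b (i # \<alpha> @ \<gamma>))"
        using b_pos[of "\<alpha> @ \<gamma>"] by simp
      also have "\<dots> \<le> C * K"
      proof (intro mult_mono C K)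
        show "0 \<le> C" by (rule order_trans[OF _ C]) (simp add: b_pos less_imp_le)
      qed (simp add: b_pos less_imp_le)
      finally show ?thesis .
    qed
    then show ?case by blast
  qed
  then obtain C where "\<And>\<gamma>. b \<gamma> / b (\<alpha> @ \<gamma>) \<le> C" by blast
  then have "\<And>\<gamma>. sqrt (b \<gamma> / b (\<alpha> @ \<gamma>)) \<le> sqrt C" by simp
  then show ?thesis using that by blast
qed

lemma shift_bound:
  obtains C where "inj_on (drop (length \<alpha>)) (range ((@) \<alpha>))"
    "\<And>\<beta>. \<beta> \<in> range ((@) \<alpha>) \<Longrightarrow> \<bar>sqrt (b (drop (length \<alpha>) \<beta>) / b \<beta>)\<bar> \<le> C"
proof -
  obtain C where C: "\<And>\<gamma>. sqrt (b \<gamma> / b (\<alpha> @ \<gamma>)) \<le> C" using weight_bound by blast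
  show ?thesis
    by (rule that[of C]) (use C b_pos in \<open>auto simp: inj_on_def less_imp_le\<close>)
qed

lemma backshift_bound:
  obtains C where "inj_on ((@) \<alpha>) UNIV" "\<And>\<gamma>. \<gamma> \<in> UNIV \<Longrightarrow> \<bar>sqrt (b \<gamma> / b (\<alpha> @ \<gamma>))\<bar> \<le> C"
proof -
  obtain C where C: "\<And>\<gamma>. sqrt (b \<gamma> / b (\<alpha> @ \<gamma>)) \<le> C" using weight_bound by blast
  show ?thesis
    by (rule that[of C]) (use C b_pos in \<open>auto simp: inj_on_def less_imp_le\<close>)
qed

lemma coord_shift:
  "l2_coord (word_shift b \<alpha> f) \<beta> =
    (if \<beta> \<in> range ((@) \<alpha>)
     then sqrt (b (drop (length \<alpha>) \<beta>) / b \<beta>) *\<^sub>R l2_coord f (drop (length \<alpha>) \<beta>) else 0)"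
  unfolding word_shift_def by (rule shift_bound[of \<alpha>]) (rule l2_coord_wcomp)

lemma coord_backshift:
  "l2_coord (word_backshift b \<alpha> f) \<gamma> = sqrt (b \<gamma> / b (\<alpha> @ \<gamma>)) *\<^sub>R l2_coord f (\<alpha> @ \<gamma>)"
  unfolding word_backshift_def 
  by (rule backshift_bound[of \<alpha>]) (subst l2_coord_wcomp, auto)

lemma bounded_clinear_shift: "bounded_clinear (word_shift b \<alpha>)"
  unfolding word_shift_def by (rule shift_bound[of \<alpha>]) (rule bounded_clinear_wcomp)

lemma bounded_clinear_backshift: "bounded_clinear (word_backshift b \<alpha>)"
  unfolding word_backshift_def by (rule backshift_bound[of \<alpha>]) (rule bounded_clinear_wcomp)

lemma ampliation_shift: "ampliation (word_shift b \<alpha>) = word_shift b \<alpha>"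
  unfolding word_shift_def by (rule shift_bound[of \<alpha>]) (rule ampliation_wcomp)

lemma ampliation_backshift: "ampliation (word_backshift b \<alpha>) = word_backshift b \<alpha>"
  unfolding word_backshift_def by (rule backshift_bound[of \<alpha>]) (rule ampliation_wcomp)

lemma sqrt_weight_mult: "sqrt (b \<alpha> / b \<beta>) * sqrt (b \<beta> / b \<gamma>) = sqrt (b \<alpha> / b \<gamma>)"
  using b_pos[of \<beta>] by (simp add: real_sqrt_mult[symmetric])

lemma shift_Nil: "word_shift b [] f = f"
  by (rule l2_eqI) (use b_pos in \<open>simp add: coord_shift less_imp_neq[symmetric]\<close>)

lemma shift_Cons: "word_shift b (i # \<alpha>) f = word_shift b [i] (word_shift b \<alpha> f)"
proof (rule l2_eqI)
  fix \<beta>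
  have "\<beta> \<in> range ((@) (i # \<alpha>)) \<longleftrightarrow> \<beta> \<in> range ((@) [i]) \<and> tl \<beta> \<in> range ((@) \<alpha>)"
    by (cases \<beta>) auto
  moreover have "drop (length (i # \<alpha>)) \<beta> = drop (length \<alpha>) (tl \<beta>)"
    by (simp add: drop_Suc)
  ultimately show "l2_coord (word_shift b (i # \<alpha>) f) \<beta>
      = l2_coord (word_shift b [i] (word_shift b \<alpha> f)) \<beta>"
    by (simp add: coord_shift sqrt_weight_mult drop_Suc mult.commute[of "sqrt (b (tl \<beta>) / b \<beta>)"])
qed

lemma backshift_Nil: "word_backshift b [] f = f"
  by (rule l2_eqI) (use b_pos in \<open>simp add: coord_backshift less_imp_neq[symmetric]\<close>)

lemma backshift_Cons: "word_backshift b (i # \<alpha>) f = word_backshift b \<alpha> (word_backshift b [i] f)"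
  by (rule l2_eqI) (simp add: coord_backshift sqrt_weight_mult)

text \<open>The coordinates of \<open>weight_op\<close> are the intended ones once its weights are
  bounded; admissibility supplies this.\<close>

lemma universal_model_eq: "universal_model b i = word_shift b [i]"
proof (rule ext, rule l2_eqI)
  fix \<phi> :: "'n fock" and \<gamma>
  have "bdd_above (range (\<lambda>\<alpha>. b \<alpha> / b (i # \<alpha>)))" using adm by (simp add: admissible_def)
  then show "l2_coord (universal_model b i \<phi>) \<gamma> = l2_coord (word_shift b [i] \<phi>) \<gamma>"
    by (cases \<gamma>)
       (auto simp: universal_model_def l2_coord_left_creation l2_coord_weight_op b_pos coord_shift
         scaleR_conv_of_real)
qed

lemma op_word_universal_model: "op_word (universal_model b) \<alpha> = word_shift b \<alpha>"
proof (induction \<alpha>)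
  case Nil
  show ?case by (auto simp: shift_Nil)
next
  case (Cons i \<alpha>)
  then show ?case by (auto simp: universal_model_eq shift_Cons[of i \<alpha>])
qed

lemma cinner_shift: "cinner (word_shift b \<alpha> f) g = cinner f (word_backshift b \<alpha> g)"
proof -
  have "cinner (word_shift b \<alpha> f) g
      = (\<Sum>\<^sub>\<infinity>\<beta>\<in>range ((@) \<alpha>). cinner (l2_coord (word_shift b \<alpha> f) \<beta>) (l2_coord g \<beta>))"
    unfolding cinner_l2_def
    by (rule infsum_cong_neutral)
       (auto simp: coord_shift linear_0[OF bounded_linear.linear[OF bounded_linear_cinner_left]])
  also have "\<dots> = cinner f (word_backshift b \<alpha> g)"
    unfolding cinner_l2_def
    by (subst infsum_reindex)
       (auto simp: inj_on_def o_def coord_shift coord_backshift intro!: infsum_cong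
         simp: bounded_linear.linear[OF bounded_linear_cinner_left, THEN linear_cmul]
          bounded_linear.linear[OF bounded_linear_cinner_right, THEN linear_cmul])
  finally show ?thesis .
qed

lemma cadjoint_shift: "cadjoint (word_shift b \<alpha>) = word_backshift b \<alpha>"
  by (rule cadjoint_eqI) (rule cinner_shift)

text \<open>For \<beta> = \<alpha>\<gamma> the forward and backward weights multiply to
  \<open>b \<gamma> / b \<beta>\<close>, so every term of the sum is diagonal.\<close>

lemma coord_partial_defect:
  "l2_coord (partial_defect b k f) \<beta> = defect_coeff b k \<beta> *\<^sub>R l2_coord f \<beta>"
proof -
  have "l2_coord (nc_inverse b \<alpha> *\<^sub>R word_shift b \<alpha> (word_backshift b \<alpha> f)) \<beta> =
    (if \<beta> \<in> range ((@) \<alpha>) then nc_inverse b \<alpha> * (b (drop (length \<alpha>) \<beta>) / b \<beta>) else 0) *\<^sub>R l2_coord f \<beta>"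
    for \<alpha>
  proof (cases "\<beta> \<in> range ((@) \<alpha>)")
    case True
    then obtain \<gamma> where "\<beta> = \<alpha> @ \<gamma>" by auto
    then show ?thesis
      using b_pos[of \<gamma>] b_pos[of "\<alpha> @ \<gamma>"]
      by (simp add: coord_shift coord_backshift real_sqrt_mult[symmetric])
  qed (simp add: coord_shift)
  then show ?thesis
    unfolding partial_defect_def defect_coeff_def l2_coord_sum scaleR_sum_left
    by (intro sum.cong refl)
qed

text \<open>Once k reaches |\<beta>|, all factorizations \<beta> = \<alpha>\<gamma> are counted, and
  the entry is the coefficient at \<beta> of the product of the inverse series with g, divided by
  \<open>b \<beta>\<close>.\<close>

lemma defect_coeff_eventually:
  assumes "length \<beta> \<le> k"
  shows "defect_coeff b k \<beta> = nc_one \<beta>"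
proof -
  \<comment> \<open>The only possible prefix of length p is \<open>take p \<beta>\<close>, so each
    block has at most one term. The guard on p is needed because beyond the end
    \<open>take p \<beta>\<close> is \<beta> itself.\<close>
  have inner: "(\<Sum>\<alpha> | length \<alpha> = p. if \<beta> \<in> range ((@) \<alpha>)
      then nc_inverse b \<alpha> * (b (drop (length \<alpha>) \<beta>) / b \<beta>) else 0)
    = (if p \<le> length \<beta> then nc_inverse b (take p \<beta>) * b (drop p \<beta>) / b \<beta> else 0)" for p
  proof -
    have "\<beta> \<in> range ((@) \<alpha>) \<longleftrightarrow> \<alpha> = take p \<beta> \<and> p \<le> length \<beta>" if "length \<alpha> = p" for \<alpha>
      using that by (auto simp: image_iff) (metis append_take_drop_id)
    then have "(\<Sum>\<alpha> | length \<alpha> = p. if \<beta> \<in> range ((@) \<alpha>)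
        then nc_inverse b \<alpha> * (b (drop (length \<alpha>) \<beta>) / b \<beta>) else 0)
      = (\<Sum>\<alpha> | length \<alpha> = p. if \<alpha> = take p \<beta> then
          (if p \<le> length \<beta> then nc_inverse b (take p \<beta>) * b (drop p \<beta>) / b \<beta> else 0) else 0)"
      by (intro sum.cong) auto
    also have "\<dots> = (if p \<le> length \<beta> then nc_inverse b (take p \<beta>) * b (drop p \<beta>) / b \<beta> else 0)"
      by (subst sum.delta) (auto simp: finite_words)
    finally show ?thesis .
  qed
  have "defect_coeff b k \<beta> = (\<Sum>p\<le>length \<beta>. nc_inverse b (take p \<beta>) * b (drop p \<beta>) / b \<beta>)"
    unfolding defect_coeff_def inner using assms
    by (intro sum.mono_neutral_cong_right) auto
  also have "\<dots> = nc_mult (nc_inverse b) b \<beta> / b \<beta>"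
    by (simp add: nc_mult_take_drop sum_divide_distrib)
  \<comment> \<open>Dividing by \<open>b \<beta>\<close> changes nothing: the coefficient vanishes
    except at the empty word, where b is 1.\<close>
  also have "\<dots> = nc_one \<beta>"
    using nc_inverse_correct(2)[of b] by (simp add: b_Nil nc_one_def)
  finally show ?thesis .
qed

lemma hom_block_universal_model:
  "hom_block c (universal_model b) id p \<phi>
    = (\<Sum>\<alpha> | length \<alpha> = p. c \<alpha> *\<^sub>R word_shift b \<alpha> (word_backshift b \<alpha> \<phi>))"
  by (simp add: hom_block_def op_word_universal_model cadjoint_shift)

text \<open>Admissibility bounds the norms of the truncated defects on scalar Fock space; testing on
  e_\<beta> bounds each diagonal entry. The entries are the same for every ampliation, so this one
  bound serves for all.\<close>

lemma defect_coeff_bounded: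
  obtains M where "\<And>k \<beta>. \<bar>defect_coeff b k \<beta>\<bar> \<le> M"
proof -
  have eq: "(\<lambda>\<phi>. \<Sum>p\<le>k. hom_block (nc_inverse b) (universal_model b) id p \<phi>) = partial_defect b k" for k
    by (rule ext) (simp add: hom_block_universal_model partial_defect_def)
  obtain M where M: "\<And>k. onorm (partial_defect b k :: 'n fock \<Rightarrow> 'n fock) \<le> M"
    using adm unfolding admissible_def bdd_above_def eq by blast
  have bl: "bounded_linear (partial_defect b k :: 'n fock \<Rightarrow> 'n fock)" for k
  proof -
    have "bounded_linear (\<lambda>\<phi> :: 'n fock. word_shift b \<alpha> (word_backshift b \<alpha> \<phi>))" for \<alpha>
      using bounded_clinear_compose[OF bounded_clinear_shift bounded_clinear_backshift]
      unfolding bounded_clinear_def by blast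
    then show ?thesis
      unfolding partial_defect_def by (intro bounded_linear_sum bounded_linear_const_scaleR)
  qed
  have "\<bar>defect_coeff b k \<beta>\<bar> \<le> M" for k \<beta>
  proof -
    have n1: "norm (l2_unit \<beta> :: 'n fock) = 1"
    proof -
      have "(norm (l2_unit \<beta> :: 'n fock))\<^sup>2 = (\<Sum>\<^sub>\<infinity>\<gamma>\<in>{\<beta>}. 1)"
        unfolding l2_norm_sq by (rule infsum_cong_neutral) auto
      then show ?thesis by (simp add: power2_eq_1_iff) (smt (verit) norm_ge_zero)
    qed
    have "\<bar>defect_coeff b k \<beta>\<bar> = norm (l2_coord (partial_defect b k (l2_unit \<beta> :: 'n fock)) \<beta>)"
      by (simp add: coord_partial_defect)
    also have "\<dots> \<le> norm (partial_defect b k (l2_unit \<beta> :: 'n fock))" by (rule l2_norm_coord_le)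
    also have "\<dots> \<le> onorm (partial_defect b k :: 'n fock \<Rightarrow> 'n fock) * norm (l2_unit \<beta> :: 'n fock)"
      by (rule onorm[OF bl])
    also have "\<dots> \<le> M" using M by (simp add: n1)
    finally show ?thesis .
  qed
  then show ?thesis using that by blast
qed

lemma partial_defect_tendsto: "(\<lambda>k. partial_defect b k f) \<longlonglongrightarrow> vacuum_proj f"
proof -
  obtain M where M: "\<And>k \<beta>. \<bar>defect_coeff b k \<beta>\<bar> \<le> M" using defect_coeff_bounded by blast
  show ?thesis
  proof (rule l2_multiplier_tendsto[where c = "defect_coeff b" and c\<^sub>0 = nc_one and M = M])
    show "l2_coord (vacuum_proj f) \<beta> = nc_one \<beta> *\<^sub>R l2_coord f \<beta>" for \<beta>
      by (simp add: vacuum_proj_def nc_one_def)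
    show "\<forall>\<^sub>F k in sequentially. defect_coeff b k \<beta> = nc_one \<beta>" for \<beta>
      using eventually_ge_at_top[of "length \<beta>"]
      by eventually_elim (rule defect_coeff_eventually)
  qed (simp_all add: coord_partial_defect M)
qed

end

section \<open>Unitary extensions\<close>

lemma csubspace_range: "bounded_clinear A \<Longrightarrow> complex_vector.subspace (range A)"
proof -
  assume A: "bounded_clinear A"
  note lin = bounded_clinear_imp_linear[OF A]
  show ?thesis
    unfolding complex_vector.subspace_def
  proof (intro conjI ballI allI)
    show "0 \<in> range A" using linear_0[OF lin] by (metis rangeI)
    show "x + y \<in> range A" if xy: "x \<in> range A" "y \<in> range A" for x y
    proof -
      obtain u v where "x = A u" "y = A v" using xy by blast
      then have "x + y = A (u + v)" by (simp add: linear_add[OF lin])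
      then show ?thesis by simp
    qed
    show "c *\<^sub>C x \<in> range A" if x: "x \<in> range A" for c x
    proof -
      obtain u where "x = A u" using x by blast
      then have "c *\<^sub>C x = A (c *\<^sub>C u)" using A by (simp add: bounded_clinear_def)
      then show ?thesis by simp
    qed
  qed
qed

lemma csubspace_closure:
  fixes S :: "'a::complex_inner set"
  assumes S: "complex_vector.subspace S"
  shows "complex_vector.subspace (closure S)"
  unfolding complex_vector.subspace_def
proof (intro conjI ballI allI)
  show "0 \<in> closure S"
    using complex_vector.subspace_0[OF S] closure_subset by blast
  show "x + y \<in> closure S" if xy: "x \<in> closure S" "y \<in> closure S" for x y
  proof -
    obtain u v where "\<And>n. u n \<in> S" "u \<longlonglongrightarrow> x" "\<And>n. v n \<in> S" "v \<longlonglongrightarrow> y"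
      using xy unfolding closure_sequential by blast
    then show ?thesis
      unfolding closure_sequential
      by (intro exI[of _ "\<lambda>n. u n + v n"]) (simp add: tendsto_add complex_vector.subspace_add[OF S])
  qed
  show "c *\<^sub>C x \<in> closure S" if x: "x \<in> closure S" for c x
  proof -
    obtain u where "\<And>n. u n \<in> S" "u \<longlonglongrightarrow> x"
      using x unfolding closure_sequential by blast
    then show ?thesis
      unfolding closure_sequential
      by (intro exI[of _ "\<lambda>n. c *\<^sub>C u n"])
         (simp add: bounded_linear.tendsto[OF bounded_linear_scaleC] complex_vector.subspace_scale[OF S])
  qed
qed

lemma closed_csubspace_closure_range: "bounded_clinear A \<Longrightarrow> closed_csubspace (closure (range A))"
  by (simp add: closed_csubspace_def csubspace_closure csubspace_range)

lemma csubspace_vimage: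
  assumes A: "bounded_clinear A" and S: "complex_vector.subspace S"
  shows "complex_vector.subspace {x. A x \<in> S}"
  using A linear_0[OF bounded_clinear_imp_linear[OF A]] linear_add[OF bounded_clinear_imp_linear[OF A]]
    complex_vector.subspace_0[OF S] complex_vector.subspace_add[OF S] complex_vector.subspace_scale[OF S]
  by (auto simp: complex_vector.subspace_def bounded_clinear_def)

lemma closed_vimage_bounded_clinear:
  assumes A: "bounded_clinear A" and "closed S"
  shows "closed {x. A x \<in> S}"
  using continuous_closed_preimage[OF linear_continuous_on closed_UNIV \<open>closed S\<close>, of A] A
  by (simp add: bounded_clinear_def vimage_def)

text \<open>The preimage of a closed subspace is again one, so minimality arguments can be carried
  out on generators.\<close>

lemma closure_span_vimage:
  assumes "bounded_clinear A" "closed N" "complex_vector.subspace N" "\<And>f. f \<in> S \<Longrightarrow> A f \<in> N"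
  shows "closure (complex_vector.span S) \<subseteq> {f. A f \<in> N}"
proof (rule closure_minimal)
  show "complex_vector.span S \<subseteq> {f. A f \<in> N}"
    by (rule complex_vector.span_minimal[OF _ csubspace_vimage[OF assms(1,3)]]) (use assms(4) in blast)
qed (rule closed_vimage_bounded_clinear[OF assms(1,2)])

lemma Cauchy_norm_eq:
  assumes A: "linear A" and B: "linear B" and eq: "\<And>h. norm (A h) = norm (B h)"
    and "Cauchy (\<lambda>n. A (s n))"
  shows "Cauchy (\<lambda>n. B (s n))"
proof -
  have "dist (B (s m)) (B (s n)) = dist (A (s m)) (A (s n))" for m n
    using eq[of "s m - s n"] by (simp add: dist_norm linear_diff[OF A] linear_diff[OF B])
  then show ?thesis using assms(4) by (simp add: Cauchy_def)
qed

lemma closure_range_sequence: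
  fixes A :: "'a \<Rightarrow> 'b::metric_space"
  assumes "x \<in> closure (range A)"
  obtains s where "(\<lambda>n. A (s n)) \<longlonglongrightarrow> x"
proof -
  obtain u where u: "\<And>n. u n \<in> range A" "u \<longlonglongrightarrow> x"
    using assms unfolding closure_sequential by blast
  from u(1) have "\<forall>n. \<exists>h. u n = A h" by blast
  then obtain s where "\<And>n. u n = A (s n)" by metis
  then have "u = (\<lambda>n. A (s n))" by blast
  then show ?thesis using u(2) that by blast
qed

text \<open>A h \<mapsto> B h is well defined and isometric because the norms agree; completeness
  extends it to the closures.\<close>

lemma unitary_extension:
  fixes A :: "'h::complex_inner \<Rightarrow> 'g::chilbert_space" and B :: "'h \<Rightarrow> 'k::chilbert_space"
  assumes A: "bounded_clinear A" and B: "bounded_clinear B" and eq: "\<And>h. norm (A h) = norm (B h)"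
  obtains U where "unitary_between (closure (range A)) (closure (range B)) U" "\<And>h. U (A h) = B h"
proof -
  note linA = bounded_clinear_imp_linear[OF A] and linB = bounded_clinear_imp_linear[OF B]
  \<comment> \<open>A single sequence s leads to x under A and to y under B. The relation is
    symmetric in A and B, so surjectivity of U is totality with the roles exchanged.\<close>
  define G where "G x y s \<longleftrightarrow> (\<lambda>n. A (s n)) \<longlonglongrightarrow> x \<and> (\<lambda>n. B (s n)) \<longlonglongrightarrow> y" for x y s
  define U where "U x = (SOME y. \<exists>s. G x y s)" for x
  have ex: "\<exists>y s. G x y s" if x: "x \<in> closure (range A)" for x
  proof -
    obtain s where s: "(\<lambda>n. A (s n)) \<longlonglongrightarrow> x"
      using x by (rule closure_range_sequence)
    have "Cauchy (\<lambda>n. B (s n))"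
      by (rule Cauchy_norm_eq[OF linA linB eq LIMSEQ_imp_Cauchy[OF s]])
    then show ?thesis using s unfolding G_def Cauchy_convergent_iff convergent_def by blast
  qed
  have ex': "\<exists>x s. G x y s" if y: "y \<in> closure (range B)" for y
  proof -
    obtain s where s: "(\<lambda>n. B (s n)) \<longlonglongrightarrow> y"
      using y by (rule closure_range_sequence)
    have "Cauchy (\<lambda>n. A (s n))"
      by (rule Cauchy_norm_eq[OF linB linA eq[symmetric] LIMSEQ_imp_Cauchy[OF s]])
    then show ?thesis using s unfolding G_def Cauchy_convergent_iff convergent_def by blast
  qed
  \<comment> \<open>Sequences with the same limit under A have the same limit under B, so the choice
    made in U is immaterial.\<close>
  have U_eq: "U x = y" if g: "G x y s" for x y s
  proof -
    have "z = y" if "G x z t" for z t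
    proof -
      have lim: "(\<lambda>n. A (s n) - A (t n)) \<longlonglongrightarrow> x - x" "(\<lambda>n. B (s n) - B (t n)) \<longlonglongrightarrow> y - z"
        using g that unfolding G_def by (intro tendsto_diff; blast)+
      have "norm (A (s n) - A (t n)) = norm (B (s n) - B (t n))" for n
        using eq[of "s n - t n"] by (simp add: linear_diff[OF linA] linear_diff[OF linB])
      then have "(\<lambda>n. norm (B (s n) - B (t n))) \<longlonglongrightarrow> norm (x - x)"
        using tendsto_norm[OF lim(1)] by simp
      from LIMSEQ_unique[OF tendsto_norm[OF lim(2)] this] show ?thesis by simp
    qed
    then show ?thesis unfolding U_def using g by (intro some_equality) blast+
  qed
  have G_closure: "x \<in> closure (range A)" "y \<in> closure (range B)" if "G x y s" for x y s
    using that unfolding G_def closure_sequential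
    by (auto intro: exI[of _ "\<lambda>n. A (s n)"] exI[of _ "\<lambda>n. B (s n)"])
  have "unitary_between (closure (range A)) (closure (range B)) U"
    unfolding unitary_between_def
  proof (intro conjI ballI allI)
    fix x assume x: "x \<in> closure (range A)"
    then obtain y s where g: "G x y s" using ex by blast
    show "norm (U x) = norm x"
    proof -
      have "(\<lambda>n. norm (A (s n))) \<longlonglongrightarrow> norm x" "(\<lambda>n. norm (A (s n))) \<longlonglongrightarrow> norm y"
        using g tendsto_norm[of "\<lambda>n. B (s n)" y] unfolding G_def by (auto intro: tendsto_norm simp: eq[symmetric])
      then show ?thesis unfolding U_eq[OF g] by (rule LIMSEQ_unique[rotated])
    qed
    show "U (c *\<^sub>C x) = c *\<^sub>C U x" for c
    proof -
      have "G (c *\<^sub>C x) (c *\<^sub>C y) (\<lambda>n. c *\<^sub>C s n)"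
        using g A B unfolding G_def bounded_clinear_def
        by (simp add: bounded_linear.tendsto[OF bounded_linear_scaleC])
      then show ?thesis by (simp add: U_eq[OF g] U_eq)
    qed
    fix x' assume "x' \<in> closure (range A)"
    then obtain y' s' where g': "G x' y' s'" using ex by blast
    have "G (x + x') (y + y') (\<lambda>n. s n + s' n)"
      using g g' unfolding G_def by (simp add: linear_add[OF linA] linear_add[OF linB] tendsto_add)
    then show "U (x + x') = U x + U x'" by (simp add: U_eq[OF g] U_eq[OF g'] U_eq)
  next
    show "U ` closure (range A) = closure (range B)"
    proof (intro equalityI subsetI)
      fix y assume "y \<in> U ` closure (range A)"
      then obtain x z s where "y = U x" "G x z s" using ex by blast
      then show "y \<in> closure (range B)" using U_eq G_closure by metis
    next
      fix y assume "y \<in> closure (range B)"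
      then obtain x s where "G x y s" using ex' by blast
      then show "y \<in> U ` closure (range A)" using U_eq G_closure by blast
    qed
  qed
  moreover have "U (A h) = B h" for h
    by (rule U_eq[of _ _ "\<lambda>_. h"]) (simp add: G_def)
  ultimately show ?thesis using that by blast
qed

section \<open>Dilations of pure tuples\<close>

lemma wot_sums_wot_suminf: "wot_summable F \<Longrightarrow> wot_sums F (wot_suminf F)"
proof -
  assume "wot_summable F"
  then obtain A where A: "wot_sums F A" by (auto simp: wot_summable_def)
  have "B = A" if "wot_sums F B" for B
  proof (rule ext, rule cinner_eqI2)
    show "cinner (B x) y = cinner (A x) y" for x y
      using A that unfolding wot_sums_def by (meson sums_unique2)
  qed
  then show ?thesis unfolding wot_suminf_def using A by (metis the_equality)
qed

text \<open>Operator series are summed by blocks of equal length, l2 norms as unordered sums over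
  words; for nonnegative terms the two agree.\<close>

lemma has_sum_words:
  fixes g :: "'n::finite list \<Rightarrow> real"
  assumes g: "\<And>\<alpha>. 0 \<le> g \<alpha>" and S: "(\<lambda>k. \<Sum>\<alpha> | length \<alpha> = k. g \<alpha>) sums S"
  shows "(g has_sum S) UNIV"
proof -
  have fin: "((\<lambda>\<alpha>. g (snd (k, \<alpha>))) has_sum (\<Sum>\<alpha> | length \<alpha> = k. g \<alpha>)) {\<alpha>. length \<alpha> = k}" for k
    using has_sum_finite[OF finite_words, of g] by simp
  have S': "((\<lambda>k. \<Sum>\<alpha> | length \<alpha> = k. g \<alpha>) has_sum S) UNIV"
    by (rule sums_nonneg_imp_has_sum[OF S]) (simp add: sum_nonneg g)
  have "(\<lambda>p. g (snd p)) summable_on (SIGMA k : UNIV. {\<alpha>. length \<alpha> = k})"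
    by (rule summable_on_SigmaI[OF fin]) (use S' g in \<open>auto simp: summable_on_def\<close>)
  then have "((\<lambda>p. g (snd p)) has_sum S) (SIGMA k : UNIV. {\<alpha>. length \<alpha> = k})"
    by (intro has_sum_SigmaI[OF fin S'])
  then show ?thesis
    by (rule has_sum_reindex_bij_witness[where j = "\<lambda>\<alpha>. (length \<alpha>, \<alpha>)" and i = snd,
          THEN iffD2, rotated 6]) auto
qed

lemma bounded_clinear_coord:
  fixes V :: "'h::complex_inner \<Rightarrow> ('i, 'a::complex_inner) l2"
  assumes "bounded_clinear V"
  shows "bounded_clinear (\<lambda>h. l2_coord (V h) i)"
proof (rule bounded_clinear_compose[OF _ assms])
  show "bounded_clinear (\<lambda>f :: ('i, 'a) l2. l2_coord f i)"
    unfolding bounded_clinear_def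
    by (auto intro!: bounded_linear_intro[where K = 1] simp: l2_norm_coord_le)
qed

lemma bounded_clinear_tensor: "bounded_clinear (\<lambda>x :: 'a::complex_inner. \<phi> \<otimes>\<^sub>2 x)"
proof -
  have "norm (\<phi> \<otimes>\<^sub>2 x) = norm \<phi> * norm x" for x :: 'a
  proof -
    have "complex_of_real ((norm (\<phi> \<otimes>\<^sub>2 x))\<^sup>2) = complex_of_real ((norm \<phi>)\<^sup>2 * (norm x)\<^sup>2)"
      by (simp only: cinner_self[symmetric] cinner_tensor of_real_mult)
    then have "(norm (\<phi> \<otimes>\<^sub>2 x))\<^sup>2 = (norm \<phi> * norm x)\<^sup>2"
      by (simp only: of_real_eq_iff power_mult_distrib)
    then show ?thesis by (simp add: power2_eq_iff_nonneg)
  qed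
  then show ?thesis
    unfolding bounded_clinear_def
    by (auto intro!: bounded_linear_intro[where K = "norm \<phi>"] l2_eqI
        simp: scaleC_add_right scaleR_scaleC_commute scaleC_scaleC mult.commute)
qed

locale pure_in_domain = admissible_series b for b :: "'n::finite list \<Rightarrow> real" +
  fixes T :: "'n \<Rightarrow> 'h::chilbert_space \<Rightarrow> 'h"
  assumes pure: "pure_tuple b T"
begin

abbreviation T_adj :: "'n list \<Rightarrow> 'h \<Rightarrow> 'h" where "T_adj \<alpha> \<equiv> cadjoint (op_word T \<alpha>)"

lemma T_bounded: "bounded_clinear (T i)"
  using pure by (simp add: pure_tuple_def nc_domain_def)

lemma bounded_clinear_T_adj: "bounded_clinear (T_adj \<alpha>)"
  by (intro bounded_clinear_cadjoint bounded_clinear_op_word T_bounded)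

lemma T_adj_Cons: "T_adj (i # \<alpha>) h = T_adj \<alpha> (cadjoint (T i) h)"
  by (rule cadjoint_op_word_Cons[OF T_bounded])

lemma defect_sums: "wot_sums (hom_block (nc_inverse b) T id) (defect b T)"
  using pure unfolding defect_def by (intro wot_sums_wot_suminf) (simp add: pure_tuple_def nc_domain_def)

lemma defect_bounded: "bounded_clinear (defect b T)"
  using defect_sums by (simp add: wot_sums_def)

lemma defect_nonneg: "nonneg_op (defect b T)"
  using pure by (simp add: pure_tuple_def nc_domain_def)

lemma pure_sums: "wot_sums (hom_block b T (defect b T)) id"
  using pure wot_sums_wot_suminf[of "hom_block b T (defect b T)"]
  by (simp add: pure_tuple_def nc_domain_def)

lemma inner_hom_block:
  "inner (hom_block c T Y k x) y = (\<Sum>\<alpha> | length \<alpha> = k. c \<alpha> * inner (Y (T_adj \<alpha> x)) (T_adj \<alpha> y))"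
  unfolding hom_block_def
  by (simp add: inner_sum_left inner_eq_Re_cinner[of "op_word T _ _"]
      inner_eq_Re_cinner[of _ "T_adj _ _"] cinner_cadjoint[OF bounded_clinear_op_word[OF T_bounded]])

lemma wot_sums_inner: "wot_sums F A \<Longrightarrow> (\<lambda>k. inner (F k x) y) sums inner (A x) y"
  unfolding wot_sums_def inner_eq_Re_cinner by (intro sums_Re) blast

section \<open>The vacuum component of a dilation and the defect operator\<close>

lemma dilation_T_adj:
  assumes "is_dilation b T \<G> V"
  shows "V (T_adj \<alpha> h) = word_backshift b \<alpha> (V h)"
proof (induction \<alpha> arbitrary: h)
  case Nil
  show ?case by (simp only: cadjoint_op_word_Nil backshift_Nil)
next
  case (Cons i \<alpha>)
  have "V (cadjoint (T i) h) = word_backshift b [i] (V h)"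
    using assms by (simp add: is_dilation_def universal_model_eq cadjoint_shift ampliation_backshift)
  then show ?case
    by (simp only: T_adj_Cons Cons backshift_Cons[of i \<alpha>])
qed

lemma dilation_coord:
  assumes "is_dilation b T \<G> V"
  shows "l2_coord (V h) \<alpha> = sqrt (b \<alpha>) *\<^sub>R l2_coord (V (T_adj \<alpha> h)) []"
  unfolding dilation_T_adj[OF assms] coord_backshift
  using b_pos[of \<alpha>] by (simp add: b_Nil real_sqrt_divide)

text \<open>The right-hand side no longer mentions V, so the vacuum components of any two dilations
  have equal norms; uniqueness rests on this.\<close>

lemma dilation_defect:
  fixes V :: "'h \<Rightarrow> ('n list, 'g::complex_inner) l2"
  assumes dil: "is_dilation b T \<G> V"
  shows "(norm (l2_coord (V h) []))\<^sup>2 = inner (defect b T h) h"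
proof -
  have "(\<lambda>k. \<Sum>p\<le>k. inner (hom_block (nc_inverse b) T id p h) h) \<longlonglongrightarrow> inner (defect b T h) h"
    using wot_sums_inner[OF defect_sums] by (simp add: sums_def_le)
  moreover have "(\<Sum>p\<le>k. inner (hom_block (nc_inverse b) T id p h) h)
      = inner (partial_defect b k (V h)) (V h)" for k
  proof -
    \<comment> \<open>V is isometric, so the norm of T_\<alpha>* h can be computed in the dilation
      space, where intertwining turns it into that of W_\<alpha>* V h.\<close>
    have "inner (T_adj \<alpha> h) (T_adj \<alpha> h) = inner (word_shift b \<alpha> (word_backshift b \<alpha> (V h))) (V h)" for \<alpha>
    proof -
      have "inner (T_adj \<alpha> h) (T_adj \<alpha> h) = inner (V (T_adj \<alpha> h)) (V (T_adj \<alpha> h))"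
        using dil by (simp add: is_dilation_def power2_norm_eq_inner[symmetric])
      then show ?thesis
        by (simp add: dilation_T_adj[OF dil] inner_eq_Re_cinner cinner_shift)
    qed
    then show ?thesis
      by (simp add: inner_hom_block partial_defect_def inner_sum_left)
  qed
  moreover have "(\<lambda>k. inner (partial_defect b k (V h)) (V h)) \<longlonglongrightarrow> inner (vacuum_proj (V h)) (V h)"
    by (intro tendsto_intros partial_defect_tendsto)
  moreover have "inner (vacuum_proj (V h)) (V h) = (norm (l2_coord (V h) []))\<^sup>2"
  proof -
    have "cinner (vacuum_proj (V h)) (V h) = (\<Sum>\<^sub>\<infinity>\<alpha>\<in>{[]}. cinner (l2_coord (V h) \<alpha>) (l2_coord (V h) \<alpha>))"
      unfolding cinner_l2_def
      by (rule infsum_cong_neutral) (auto simp: vacuum_proj_def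
          linear_0[OF bounded_linear.linear[OF bounded_linear_cinner_left]])
    then show ?thesis by (simp add: inner_eq_Re_cinner cinner_self)
  qed
  ultimately show ?thesis using LIMSEQ_unique by fastforce
qed

text \<open>Shifts by nonempty words produce vacuum coordinate 0, so the vacuum coordinates of all
  generators lie in the closed range of the vacuum component; density of their span leaves no room
  for a larger \<G>.\<close>

lemma minimal_dilation_space:
  fixes \<G> :: "'g::complex_inner set"
  assumes "is_minimal_dilation b T \<G> V"
  shows "\<G> = closure (range (\<lambda>h. l2_coord (V h) []))"
proof -
  have dil: "is_dilation b T \<G> V"
    and min: "closure (complex_vector.span {word_shift b \<alpha> (V h) | \<alpha> h. True}) = tensor_space \<G>"
    using assms by (auto simp: is_minimal_dilation_def op_word_universal_model ampliation_shift)
  have G: "closed_csubspace \<G>" and V: "bounded_clinear V" and ran: "range V \<subseteq> tensor_space \<G>"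
    using dil by (auto simp: is_dilation_def)
  define R where "R = closure (range (\<lambda>h. l2_coord (V h) []))"
  have R: "closed R" "complex_vector.subspace R"
    using closed_csubspace_closure_range[OF bounded_clinear_coord[OF V, of "[]"]]
    by (auto simp: R_def closed_csubspace_def)
  have "range (\<lambda>h. l2_coord (V h) []) \<subseteq> \<G>"
    using ran unfolding tensor_space_eq[OF G] by blast
  then have 1: "R \<subseteq> \<G>"
    unfolding R_def using G by (intro closure_minimal) (auto simp: closed_csubspace_def)
  have "tensor_space \<G> \<subseteq> {f :: ('n list, 'g) l2. l2_coord f [] \<in> R}"
    unfolding min[symmetric]
  proof (rule closure_span_vimage[OF bounded_clinear_coord[OF bounded_clinear_id] R])
    fix f assume "f \<in> {word_shift b \<alpha> (V h) | \<alpha> h. True}"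
    then obtain \<alpha> h where f: "f = word_shift b \<alpha> (V h)" by auto
    have "l2_coord (V h) [] \<in> R"
      unfolding R_def by (rule subsetD[OF closure_subset]) simp
    then show "l2_coord f [] \<in> R"
      using complex_vector.subspace_0[OF R(2)] unfolding f
      by (cases \<alpha>) (auto simp: coord_shift b_Nil)
  qed
  \<comment> \<open>Every x in \<G> occurs as a vacuum coordinate in the dilation space, namely that
    of e_[] \<otimes> x.\<close>
  moreover have "(l2_unit [] \<otimes>\<^sub>2 x :: ('n list, 'g) l2) \<in> tensor_space \<G>" if "x \<in> \<G>" for x
    unfolding tensor_space_def using that
    by (intro subsetD[OF closure_subset] complex_vector.span_base) blast
  ultimately have "x \<in> R" if "x \<in> \<G>" for x
    using that by (metis (mono_tags, lifting) complex_vector.scale_one l2_coord_tensor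
        l2_coord_unit mem_Collect_eq subsetD)
  then show ?thesis using 1 unfolding R_def by blast
qed

text \<open>The unitary is I \<otimes> U, where U extends the map between the vacuum components.
  Acting coordinatewise, it commutes with the shifts, and it matches V with V' because all
  coordinates are determined by the vacuum one.\<close>

lemma minimal_dilations_isomorphic:
  fixes \<G> :: "'g::chilbert_space set" and \<G>' :: "'k::chilbert_space set"
  assumes m: "is_minimal_dilation b T \<G> V" and m': "is_minimal_dilation b T \<G>' V'"
  shows "isomorphic_dilations b \<G> V \<G>' V'"
proof -
  have dil: "is_dilation b T \<G> V" and dil': "is_dilation b T \<G>' V'"
    using m m' by (auto simp: is_minimal_dilation_def)
  have G: "closed_csubspace \<G>" "closed_csubspace \<G>'" "bounded_clinear V" "bounded_clinear V'"
    "range V \<subseteq> tensor_space \<G>"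
    using dil dil' by (auto simp: is_dilation_def)
  note sub = G(1)[unfolded closed_csubspace_def, THEN conjunct1]
  have norm_eq: "norm (l2_coord (V h) []) = norm (l2_coord (V' h) [])" for h
  proof -
    have "(norm (l2_coord (V h) []))\<^sup>2 = (norm (l2_coord (V' h) []))\<^sup>2"
      by (simp only: dilation_defect[OF dil] dilation_defect[OF dil'])
    then show ?thesis by (simp add: power2_eq_iff_nonneg)
  qed
  obtain U where ext: "unitary_between (closure (range (\<lambda>h. l2_coord (V h) [])))
        (closure (range (\<lambda>h. l2_coord (V' h) []))) U"
      "\<And>h. U (l2_coord (V h) []) = l2_coord (V' h) []"
    by (rule unitary_extension[OF bounded_clinear_coord[OF G(3)] bounded_clinear_coord[OF G(4)] norm_eq])
       (rule that)
  have U: "unitary_between \<G> \<G>' U" "U (l2_coord (V h) []) = l2_coord (V' h) []" for h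
    using ext by (simp_all only: minimal_dilation_space[OF m, symmetric] minimal_dilation_space[OF m', symmetric])
  have U_lin: "U (x + y) = U x + U y" "U (c *\<^sub>C x) = c *\<^sub>C U x" "norm (U x) = norm x" "U x \<in> \<G>'"
    if "x \<in> \<G>" "y \<in> \<G>" for x y c
    using U(1) that unfolding unitary_between_def by blast+
  have zero: "0 \<in> \<G>" by (rule complex_vector.subspace_0[OF sub])
  have U_R: "U (r *\<^sub>R x) = r *\<^sub>R U x" if "x \<in> \<G>" for r x
    using U_lin(2)[OF that that, of "of_real r"] by (simp add: scaleC_of_real)
  have U0: "U 0 = 0" using U_R[OF zero, of 0] by simp
  \<comment> \<open>This is I \<otimes> U. Nothing is known about U outside \<G>, so W is used only
    on \<open>tensor_space \<G>\<close>.\<close>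
  define W where "W f = Abs_l2 (\<lambda>i. U (l2_coord f i))" for f :: "('n list, 'g) l2"
  have mem: "l2_coord f i \<in> \<G>" if "f \<in> tensor_space \<G>" for f :: "('n list, 'g) l2" and i
    using that unfolding tensor_space_eq[OF G(1)] by blast
  have W: "l2_coord (W f) i = U (l2_coord f i)" if f: "f \<in> tensor_space \<G>" for f i
  proof -
    have "(\<lambda>i. (norm (U (l2_coord f i)))\<^sup>2) = (\<lambda>i. (norm (l2_coord f i))\<^sup>2)"
      using U_lin(3)[OF mem[OF f] mem[OF f]] by simp
    then show ?thesis unfolding W_def using l2_summable[of f] by (simp add: Abs_l2_inverse)
  qed
  have ts: "f + f' \<in> tensor_space \<G>" "c *\<^sub>C f \<in> tensor_space \<G>" "word_shift b \<alpha> f \<in> tensor_space \<G>"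
    if "f \<in> tensor_space \<G>" "f' \<in> tensor_space \<G>" for f f' :: "('n list, 'g) l2" and c \<alpha>
    using that complex_vector.subspace_add[OF sub] complex_vector.subspace_scale[OF sub] zero
      complex_vector.subspace_scale[OF sub, of _ "of_real r" for r]
    unfolding tensor_space_eq[OF G(1)] by (auto simp: coord_shift scaleC_of_real)
  have VT: "V h \<in> tensor_space \<G>" for h using G(5) by blast
  have "unitary_between (tensor_space \<G>) (tensor_space \<G>') W"
    unfolding unitary_between_def
  proof (intro conjI ballI allI)
    fix f :: "('n list, 'g) l2" assume f: "f \<in> tensor_space \<G>"
    show "norm (W f) = norm f"
    proof -
      have "(norm (W f))\<^sup>2 = (norm f)\<^sup>2"
        unfolding l2_norm_sq by (simp add: W[OF f] U_lin(3)[OF mem[OF f] mem[OF f]])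
      then show ?thesis by (simp add: power2_eq_iff_nonneg)
    qed
    show "W (c *\<^sub>C f) = c *\<^sub>C W f" for c
      by (rule l2_eqI) (simp add: W[OF f] W[OF ts(2)[OF f f]] U_lin(2)[OF mem[OF f] mem[OF f]])
    fix f' :: "('n list, 'g) l2" assume f': "f' \<in> tensor_space \<G>"
    show "W (f + f') = W f + W f'"
      by (rule l2_eqI) (simp add: W[OF f] W[OF f'] W[OF ts(1)[OF f f']] U_lin(1)[OF mem[OF f] mem[OF f']])
  next
    show "W ` tensor_space \<G> = tensor_space \<G>'"
    proof (intro equalityI subsetI)
      fix g assume "g \<in> W ` tensor_space \<G>"
      then show "g \<in> tensor_space \<G>'"
        unfolding tensor_space_eq[OF G(2)] using W mem U_lin(4) by fastforce
    next
      fix g :: "('n list, 'k) l2" assume "g \<in> tensor_space \<G>'"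
      then have "l2_coord g i \<in> U ` \<G>" for i
        using U(1) unfolding unitary_between_def tensor_space_eq[OF G(2)] by simp
      then have "\<forall>i. \<exists>x\<in>\<G>. U x = l2_coord g i" by (metis imageE)
      then obtain x where x: "\<And>i. x i \<in> \<G>" "\<And>i. U (x i) = l2_coord g i" by metis
      \<comment> \<open>U is isometric, so preimages chosen coordinate by coordinate form a
        square-summable family.\<close>
      have "(\<lambda>i. (norm (x i))\<^sup>2) = (\<lambda>i. (norm (l2_coord g i))\<^sup>2)"
        using U_lin(3)[OF x(1) x(1)] x(2) by metis
      then have c: "l2_coord (Abs_l2 x) = x" using l2_summable[of g] by (simp add: Abs_l2_inverse)
      then have f: "Abs_l2 x \<in> tensor_space \<G>" using x(1) by (simp add: tensor_space_eq[OF G(1)])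
      moreover have "W (Abs_l2 x) = g" by (rule l2_eqI) (simp add: W[OF f] c x(2))
      ultimately show "g \<in> W ` tensor_space \<G>" by blast
    qed
  qed
  moreover have "W (ampliation (universal_model b i) f) = ampliation (universal_model b i) (W f)"
    if f: "f \<in> tensor_space \<G>" for i f
    unfolding universal_model_eq ampliation_shift
    by (rule l2_eqI) (simp add: W[OF f] W[OF ts(3)[OF f f]] coord_shift U_R[OF mem[OF f]] U0)
  moreover have "W (V h) = V' h" for h
  proof (rule l2_eqI)
    fix \<alpha>
    have "l2_coord (W (V h)) \<alpha> = U (sqrt (b \<alpha>) *\<^sub>R l2_coord (V (T_adj \<alpha> h)) [])"
      by (simp only: W[OF VT] dilation_coord[OF dil, of h \<alpha>])
    also have "\<dots> = l2_coord (V' h) \<alpha>"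
      by (simp only: U_R[OF mem[OF VT]] U(2) dilation_coord[OF dil', of h \<alpha>])
    finally show "l2_coord (W (V h)) \<alpha> = l2_coord (V' h) \<alpha>" .
  qed
  ultimately show ?thesis unfolding isomorphic_dilations_def by blast
qed

text \<open>The closed span M of the generators contains the vacuum parts of all V h as limits of
  truncated defects. Shifting these gives e_\<alpha> \<otimes> x for x in a dense subset of \<G>,
  hence everything.\<close>

lemma minimal_dilationI:
  fixes \<G> :: "'g::complex_inner set"
  assumes dil: "is_dilation b T \<G> V" and \<G>: "\<G> = closure (range (\<lambda>h. l2_coord (V h) []))"
  shows "is_minimal_dilation b T \<G> V"
proof -
  define S where "S = {word_shift b \<alpha> (V h) | \<alpha> h. True}"
  define M where "M = closure (complex_vector.span S)"
  have G: "closed_csubspace \<G>" and V: "bounded_clinear V" and ran: "range V \<subseteq> tensor_space \<G>"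
    using dil by (auto simp: is_dilation_def)
  have M: "closed M" "complex_vector.subspace M"
    unfolding M_def by (auto intro: csubspace_closure complex_vector.subspace_span)
  have S_M: "S \<subseteq> M" unfolding M_def using closure_subset complex_vector.span_superset by blast
  have M_R: "r *\<^sub>R f \<in> M" if "f \<in> M" for r f
    using complex_vector.subspace_scale[OF M(2) that, of "of_real r"] by (simp add: scaleC_of_real)
  have "M \<subseteq> {f. l2_coord f \<alpha> \<in> \<G>}" for \<alpha>
    unfolding M_def
  proof (rule closure_span_vimage[OF bounded_clinear_coord[OF bounded_clinear_id]])
    have "l2_coord (V h) \<beta> \<in> \<G>" for h \<beta>
      using ran unfolding tensor_space_eq[OF G] by blast
    moreover have "0 \<in> \<G>"
      using G by (simp add: closed_csubspace_def complex_vector.subspace_0)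
    moreover have "r *\<^sub>R x \<in> \<G>" if "x \<in> \<G>" for r x
      using G that complex_vector.subspace_scale[of \<G> x "of_real r"]
      by (auto simp: closed_csubspace_def scaleC_of_real)
    ultimately show "l2_coord f \<alpha> \<in> \<G>" if "f \<in> S" for f
      using that by (auto simp: S_def coord_shift)
  qed (use G in \<open>auto simp: closed_csubspace_def\<close>)
  then have 1: "M \<subseteq> tensor_space \<G>"
    unfolding tensor_space_eq[OF G] by blast
  have step: "word_shift b [i] f \<in> M" if "f \<in> M" for i f
  proof -
    have "M \<subseteq> {f. word_shift b [i] f \<in> M}"
      unfolding M_def
    proof (rule closure_span_vimage[OF bounded_clinear_shift M[unfolded M_def]])
      fix f assume "f \<in> S"
      then obtain \<alpha> h where "f = word_shift b \<alpha> (V h)" by (auto simp: S_def)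
      then have "word_shift b [i] f \<in> S" unfolding S_def by (auto simp: shift_Cons[of i \<alpha>, symmetric])
      then show "word_shift b [i] f \<in> closure (complex_vector.span S)" using S_M unfolding M_def by blast
    qed
    then show ?thesis using that by blast
  qed
  have inv: "word_shift b \<alpha> f \<in> M" if "f \<in> M" for \<alpha> f
  proof (induction \<alpha>)
    case Nil
    show ?case by (simp only: shift_Nil that)
  next
    case (Cons i \<alpha>)
    show ?case unfolding shift_Cons[of i \<alpha>] by (rule step[OF Cons])
  qed
  have vac: "vacuum_proj (V h) \<in> M" for h
  proof (rule Lim_in_closed_set[OF M(1) _ _ partial_defect_tendsto[of "V h"]])
    \<comment> \<open>Intertwining rewrites W_\<alpha>* V h as V T_\<alpha>* h, so each term of the
      truncated defect is a scalar multiple of a generator.\<close>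
    have "word_shift b \<alpha> (word_backshift b \<alpha> (V h)) \<in> M" for \<alpha>
      unfolding dilation_T_adj[OF dil, symmetric] using S_M by (auto simp: S_def)
    then have "partial_defect b k (V h) \<in> M" for k
      unfolding partial_defect_def by (intro complex_vector.subspace_sum[OF M(2)] M_R)
    then show "\<forall>\<^sub>F k in sequentially. partial_defect b k (V h) \<in> M" by simp
  qed simp
  have unit: "l2_unit \<alpha> \<otimes>\<^sub>2 x \<in> M" if "x \<in> \<G>" for \<alpha> x
  proof -
    have "range (\<lambda>h. l2_coord (V h) []) \<subseteq> {x. l2_unit \<alpha> \<otimes>\<^sub>2 x \<in> M}"
    proof clarify
      fix h
      \<comment> \<open>W_\<alpha> sends e_[] \<otimes> x to e_\<alpha> \<otimes> x divided by
        \<surd>b_\<alpha>; the scalar in front undoes this weight.\<close>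
      have "l2_unit \<alpha> \<otimes>\<^sub>2 l2_coord (V h) [] = sqrt (b \<alpha>) *\<^sub>R word_shift b \<alpha> (vacuum_proj (V h))"
      proof (rule l2_eqI)
        fix \<beta>
        have "\<beta> = \<alpha> \<longleftrightarrow> \<beta> \<in> range ((@) \<alpha>) \<and> drop (length \<alpha>) \<beta> = []" by auto
        then show "l2_coord (l2_unit \<alpha> \<otimes>\<^sub>2 l2_coord (V h) []) \<beta>
            = l2_coord (sqrt (b \<alpha>) *\<^sub>R word_shift b \<alpha> (vacuum_proj (V h))) \<beta>"
          using b_pos[of \<alpha>]
          by (auto simp: coord_shift vacuum_proj_def b_Nil real_sqrt_divide)
      qed
      then show "l2_unit \<alpha> \<otimes>\<^sub>2 l2_coord (V h) [] \<in> M" using M_R inv vac by simp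
    qed
    then have "\<G> \<subseteq> {x. l2_unit \<alpha> \<otimes>\<^sub>2 x \<in> M}"
      unfolding \<G>
      by (intro closure_minimal closed_vimage_bounded_clinear bounded_clinear_tensor M)
    then show ?thesis using that by blast
  qed
  have "f \<in> M" if f: "f \<in> tensor_space \<G>" for f
  proof (rule Lim_in_closed_set[OF M(1)])
    \<comment> \<open>The truncation of f to words of length at most k, a finite sum because there
      are finitely many letters.\<close>
    let ?F = "\<lambda>k. \<Sum>p\<le>k. \<Sum>\<alpha> | length \<alpha> = p. l2_unit \<alpha> \<otimes>\<^sub>2 l2_coord f \<alpha>"
    have "?F k \<in> M" for k
      using f unfolding tensor_space_eq[OF G] by (intro complex_vector.subspace_sum[OF M(2)] unit) auto
    then show "\<forall>\<^sub>F k in sequentially. ?F k \<in> M" by simp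
    show "?F \<longlonglongrightarrow> f"
    proof (rule l2_multiplier_tendsto[where c = "\<lambda>k \<beta>. if length \<beta> \<le> k then 1 else 0"
          and c\<^sub>0 = "\<lambda>_. 1" and M = 1])
      show "l2_coord (?F k) \<beta> = (if length \<beta> \<le> k then 1 else 0) *\<^sub>R l2_coord f \<beta>" for k \<beta>
      proof -
        have "l2_coord (?F k) \<beta> = (\<Sum>p\<le>k. \<Sum>\<alpha> | length \<alpha> = p. if \<beta> = \<alpha> then l2_coord f \<beta> else 0)"
          unfolding l2_coord_sum by (intro sum.cong) auto
        also have "\<dots> = (\<Sum>p\<le>k. if p = length \<beta> then l2_coord f \<beta> else 0)"
          by (intro sum.cong refl) (subst sum.delta', auto simp: finite_words)
        finally show ?thesis by simp
      qed
      show "\<forall>\<^sub>F k in sequentially. (if length \<beta> \<le> k then 1 else 0) = (1 :: real)" for \<beta> :: "'n list"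
        using eventually_ge_at_top[of "length \<beta>"] by eventually_elim simp
    qed auto
  qed simp
  then have "M = tensor_space \<G>" using 1 by blast
  then show ?thesis
    using dil by (simp add: is_minimal_dilation_def op_word_universal_model ampliation_shift M_def S_def)
qed

text \<open>The coordinate of V h at \<alpha> is \<surd>b_\<alpha> R T_\<alpha>* h with R a root of
  the defect operator. Since \<G> is the closed range of R, it fits inside
  \<open>'h\<close>.\<close>

lemma minimal_dilation_exists: "\<exists>(\<G> :: 'h set) V. is_minimal_dilation b T \<G> V"
proof -
  obtain R :: "'h \<Rightarrow> 'h" where R: "bounded_clinear R"
    "\<And>x. (norm (R x))\<^sup>2 = Re (cinner (defect b T x) x)"
    using nonneg_op_root[OF defect_bounded defect_nonneg] by blast
  note linR = bounded_clinear_imp_linear[OF R(1)]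
  \<comment> \<open>Purity in scalar form; it gives at once the square-summability of V h and the
    isometry of V.\<close>
  have sum: "((\<lambda>\<alpha>. (norm (sqrt (b \<alpha>) *\<^sub>R R (T_adj \<alpha> h)))\<^sup>2) has_sum (norm h)\<^sup>2) UNIV" for h
  proof (rule has_sum_words)
    have "(norm (sqrt (b \<alpha>) *\<^sub>R R (T_adj \<alpha> h)))\<^sup>2
        = b \<alpha> * inner (defect b T (T_adj \<alpha> h)) (T_adj \<alpha> h)" for \<alpha>
      using b_pos[of \<alpha>] by (simp add: power_mult_distrib R(2) inner_eq_Re_cinner)
    then show "(\<lambda>k. \<Sum>\<alpha> | length \<alpha> = k. (norm (sqrt (b \<alpha>) *\<^sub>R R (T_adj \<alpha> h)))\<^sup>2) sums (norm h)\<^sup>2"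
      using wot_sums_inner[OF pure_sums, of h h] by (simp add: inner_hom_block power2_norm_eq_inner)
  qed simp
  define V :: "'h \<Rightarrow> ('n list, 'h) l2" where "V h = Abs_l2 (\<lambda>\<alpha>. sqrt (b \<alpha>) *\<^sub>R R (T_adj \<alpha> h))" for h
  have coord: "l2_coord (V h) \<alpha> = sqrt (b \<alpha>) *\<^sub>R R (T_adj \<alpha> h)" for h \<alpha>
    unfolding V_def using sum[of h] by (subst Abs_l2_inverse) (auto simp: summable_on_def)
  have norm_V: "norm (V h) = norm h" for h
  proof -
    have "(norm (V h))\<^sup>2 = (norm h)\<^sup>2"
      unfolding l2_norm_sq[of "V h"] coord by (rule infsumI[OF sum])
    then show ?thesis by (simp add: power2_eq_iff_nonneg)
  qed
  have L: "bounded_clinear (\<lambda>h. R (T_adj \<alpha> h))" for \<alpha>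
    by (rule bounded_clinear_compose[OF R(1) bounded_clinear_T_adj])
  have lin: "R (T_adj \<alpha> (x + y)) = R (T_adj \<alpha> x) + R (T_adj \<alpha> y)"
    "R (T_adj \<alpha> (c *\<^sub>C x)) = c *\<^sub>C R (T_adj \<alpha> x)" "R (T_adj \<alpha> (r *\<^sub>R x)) = r *\<^sub>R R (T_adj \<alpha> x)" for \<alpha> x y c r
    using L[of \<alpha>] linear_add[OF bounded_clinear_imp_linear[OF L[of \<alpha>]]]
      linear_cmul[OF bounded_clinear_imp_linear[OF L[of \<alpha>]]]
    by (simp_all add: bounded_clinear_def)
  have V: "bounded_clinear V"
    unfolding bounded_clinear_def
    by (auto intro!: bounded_linear_intro[where K = 1] l2_eqI
        simp: coord lin norm_V scaleR_add_right scaleR_scaleC_commute)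
  have vac: "l2_coord (V h) [] = R h" for h
    unfolding coord cadjoint_op_word_Nil by (simp add: b_Nil)
  define \<G> where "\<G> = closure (range R)"
  have G: "closed_csubspace \<G>" unfolding \<G>_def by (rule closed_csubspace_closure_range[OF R(1)])
  have "l2_coord (V h) \<alpha> \<in> \<G>" for h \<alpha>
    unfolding coord \<G>_def linear_cmul[OF linR, symmetric]
    by (rule subsetD[OF closure_subset]) simp
  then have ran: "range V \<subseteq> tensor_space \<G>" unfolding tensor_space_eq[OF G] by blast
  have "V (cadjoint (T i) h) = ampliation (cadjoint (universal_model b i)) (V h)" for i h
    unfolding universal_model_eq cadjoint_shift ampliation_backshift
  proof (rule l2_eqI)
    fix \<alpha>
    \<comment> \<open>The factor \<surd>b at the word i\<alpha> cancels the denominator of the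
      backshift weight and leaves \<surd>b_\<alpha>.\<close>
    show "l2_coord (V (cadjoint (T i) h)) \<alpha> = l2_coord (word_backshift b [i] (V h)) \<alpha>"
      using b_pos[of "i # \<alpha>"]
      by (simp add: coord coord_backshift T_adj_Cons[symmetric] real_sqrt_divide del: op_word.simps)
  qed
  then have "is_dilation b T \<G> V"
    unfolding is_dilation_def using G V norm_V ran by blast
  then have "is_minimal_dilation b T \<G> V"
    by (rule minimal_dilationI) (simp add: vac \<G>_def)
  then show ?thesis by blast
qed

end

text \<open>The filter \<open>filtercomap length at_top\<close> expresses |\<gamma>| \<rightarrow>
  \<infinity>. Types cannot be quantified existentially, so existence places \<G> inside
  \<open>'h\<close>, while uniqueness compares dilations in arbitrary ambient spaces
  \<open>'g\<close> and \<open>'k\<close>.\<close>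

theorem theorem3p8:
  fixes b :: "'n::finite list \<Rightarrow> real"
    and T :: "'n \<Rightarrow> 'h::chilbert_space \<Rightarrow> 'h"
  assumes "admissible b"
    and "\<And>i p. ((\<lambda>\<gamma>. b (p # \<gamma>) / b (i # p # \<gamma>) - b \<gamma> / b (p # \<gamma>)) \<longlongrightarrow> 0)
      (filtercomap length at_top)"
    and "\<exists>A. bounded_clinear A \<and>
      (\<lambda>N. onorm (\<lambda>\<phi>. (\<Sum>k = 1..N. hom_block (nc_inverse b) (universal_model b) id k \<phi>) - A \<phi>))
        \<longlonglongrightarrow> 0"
    and "pure_tuple b T"
  shows "(\<exists>(\<G> :: 'h set) V. is_minimal_dilation b T \<G> V) \<and>
    (\<forall>(\<G> :: 'g::chilbert_space set) V (\<G>' :: 'k::chilbert_space set) V'.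
      is_minimal_dilation b T \<G> V \<longrightarrow> is_minimal_dilation b T \<G>' V' \<longrightarrow>
      isomorphic_dilations b \<G> V \<G>' V')"
proof -
  interpret pure_in_domain b T by unfold_locales fact+
  show ?thesis using minimal_dilation_exists minimal_dilations_isomorphic by blast
qed

end
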